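(* Let $\xi$ be a Higgs tensor on $\mathbb{T}^n$ whose real and imaginary parts are each (positive or negative) semidefinite. Then the extremal (critical) points $u$ of the periodic HK-energy $\widehat{\mathcal F}(\cdot,\xi)$ in $$\mathcal A'(\xi)=\left\{u\text{ symplectic potential}: \mathrm{Tr}(\xi\,D^2u\,\bar\xi\,D^2u)<1\text{ everywhere}\right\}$$ are minima, and are unique up to additive constants.
   Context: $\mathbb{T}^n=\mathbb{R}^n/\mathbb{Z}^n$ with coordinates $y$ and Lebesgue measure $d\mu$. A symplectic potential is a function $u(y)=\frac12|y|^2+\phi(y)$ with $\phi$ smooth and $\mathbb{Z}^n$-periodic and $D^2u$ positive definite everywhere. A Higgs tensor is a smooth $\mathbb{Z}^n$-periodic function $\xi=(\xi^{ab}(y))$ with values in complex symmetric $n\times n$ matrices; $\bar\xi$ is its complex conjugate. For $u\in\mathcal A'(\xi)$ the matrix $\xi\,D^2u\,\bar\xi\,D^2u$ is diagonalizable with eigenvalues in $[0,1)$. For $x\in[0,1]$ let $f(x)=1-(1-x)^{1/2}+\log(1+(1-x)^{1/2})$ and set $\rho(\xi\,D^2u\,\bar\xi\,D^2u)=\mathrm{Tr}\,f(\xi\,D^2u\,\bar\xi\,D^2u)$ (the sum of $f$ over the eigenvalues). The periodic HK-energy is $$\widehat{\mathcal F}(u,\xi)=-\frac12\int_{\mathbb T^n}\log\det(D^2u)\,d\mu+\frac12\int_{\mathbb T^n}\rho(\xi\,D^2u\,\bar\xi\,D^2u)\,d\mu.$$ An extremal point is a $u$ with $\frac{d}{dt}\big|_{t=0}\widehat{\mathcal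 F}(u+t\varphi,\xi)=0$ for all smooth $\mathbb{Z}^n$-periodic $\varphi$. Minima are minima of $\widehat{\mathcal F}(\cdot,\xi)$ over $\mathcal A'(\xi)$. *)

theory Defs
  imports "HOL-Analysis.Analysis" "HOL-Computational_Algebra.Polynomial"
begin

text \<open>
  Objects on the torus $\mathbb{R}^n/\mathbb{Z}^n$ are functions on \<open>real ^ 'n\<close> that are invariant
  under integer translations.
\<close>

definition zn_periodic :: "(real ^ 'n \<Rightarrow> 'b) \<Rightarrow> bool" where
  "zn_periodic f \<longleftrightarrow> (\<forall>y m. (\<forall>i. m $ i \<in> \<int>) \<longrightarrow> f (y + m) = f y)"

definition partial_deriv :: "'n \<Rightarrow> (real ^ 'n \<Rightarrow> 'b::real_normed_vector) \<Rightarrow> real ^ 'n \<Rightarrow> 'b" where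
  "partial_deriv i f y = frechet_derivative f (at y) (axis i 1)"

text \<open>
  Differentiability of every iterated partial derivative (including the function itself) makes all
  of them continuous, so this is the class $C^\infty$.
\<close>

definition smooth :: "(real ^ 'n \<Rightarrow> 'b::real_normed_vector) \<Rightarrow> bool" where
  "smooth f \<longleftrightarrow> (\<forall>idx. foldr partial_deriv idx f differentiable_on UNIV)"

definition hessian :: "(real ^ 'n \<Rightarrow> real) \<Rightarrow> real ^ 'n \<Rightarrow> real ^ 'n ^ 'n" where
  "hessian u y = (\<chi> i j. partial_deriv i (partial_deriv j u) y)"

definition pos_definite :: "real ^ 'n ^ 'n \<Rightarrow> bool" where
  "pos_definite A \<longleftrightarrow> transpose A = A \<and> (\<forall>v. v \<noteq> 0 \<longrightarrow> v \<bullet> (A *v v) > 0)"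

definition pos_semidefinite :: "real ^ 'n ^ 'n \<Rightarrow> bool" where
  "pos_semidefinite A \<longleftrightarrow> transpose A = A \<and> (\<forall>v. v \<bullet> (A *v v) \<ge> 0)"

definition neg_semidefinite :: "real ^ 'n ^ 'n \<Rightarrow> bool" where
  "neg_semidefinite A \<longleftrightarrow> transpose A = A \<and> (\<forall>v. v \<bullet> (A *v v) \<le> 0)"

definition symplectic_potential :: "(real ^ 'n \<Rightarrow> real) \<Rightarrow> bool" where
  "symplectic_potential u \<longleftrightarrow>
     (\<exists>\<phi>. smooth \<phi> \<and> zn_periodic \<phi> \<and> u = (\<lambda>y. (norm y)\<^sup>2 / 2 + \<phi> y)) \<and>
     (\<forall>y. pos_definite (hessian u y))"

definition higgs_tensor :: "(real ^ 'n \<Rightarrow> complex ^ 'n ^ 'n) \<Rightarrow> bool" where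
  "higgs_tensor \<xi> \<longleftrightarrow> smooth \<xi> \<and> zn_periodic \<xi> \<and> (\<forall>y. transpose (\<xi> y) = \<xi> y)"

definition hk_matrix ::
    "(real ^ 'n \<Rightarrow> real) \<Rightarrow> (real ^ 'n \<Rightarrow> complex ^ 'n ^ 'n) \<Rightarrow> real ^ 'n \<Rightarrow> complex ^ 'n ^ 'n" where
  "hk_matrix u \<xi> y =
     \<xi> y ** map_matrix complex_of_real (hessian u y) **
     map_matrix cnj (\<xi> y) ** map_matrix complex_of_real (hessian u y)"

text \<open>
  The trace of \<^const>\<open>hk_matrix\<close> is a real number: its complex conjugate is
  $\mathrm{Tr}(\bar\xi\,D^2u\,\xi\,D^2u)$, which is the same by cyclicity. Hence \<^const>\<open>Re\<close>
  loses no information.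
\<close>

definition admissible :: "(real ^ 'n \<Rightarrow> complex ^ 'n ^ 'n) \<Rightarrow> (real ^ 'n \<Rightarrow> real) set" where
  "admissible \<xi> = {u. symplectic_potential u \<and> (\<forall>y. Re (trace (hk_matrix u \<xi> y)) < 1)}"

definition charpoly :: "'a::comm_ring_1 ^ 'n ^ 'n \<Rightarrow> 'a poly" where
  "charpoly A = det (mat [:0, 1:] - map_matrix (\<lambda>a. [:a:]) A)"

definition eigenvalues :: "'a::idom ^ 'n ^ 'n \<Rightarrow> 'a multiset" where
  "eigenvalues A = proots (charpoly A)"

definition hk_fun :: "real \<Rightarrow> real" where
  "hk_fun x = 1 - sqrt (1 - x) + ln (1 + sqrt (1 - x))"

text \<open>
  Sum over the eigenvalues with multiplicity. It is only used for matrices whose eigenvalues are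
  real and lie in $[0,1)$, so \<^const>\<open>Re\<close> is merely a coercion.
\<close>

definition hk_rho :: "complex ^ 'n ^ 'n \<Rightarrow> real" where
  "hk_rho A = (\<Sum>z\<in>#eigenvalues A. hk_fun (Re z))"

text \<open>
  The unit cube is a fundamental domain of the torus; its boundary is a null set.
\<close>

definition hk_energy :: "(real ^ 'n \<Rightarrow> real) \<Rightarrow> (real ^ 'n \<Rightarrow> complex ^ 'n ^ 'n) \<Rightarrow> real" where
  "hk_energy u \<xi> =
     - (1/2) * (LINT y:cbox 0 1|lborel. ln (det (hessian u y)))
     + (1/2) * (LINT y:cbox 0 1|lborel. hk_rho (hk_matrix u \<xi> y))"

text \<open>
  Only values at $t$ near 0 matter here, and for those \<open>u + t \<phi>\<close> is again admissible because
  admissibility is an open condition on the Hessian of a periodic perturbation.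
\<close>

definition hk_extremal :: "(real ^ 'n \<Rightarrow> complex ^ 'n ^ 'n) \<Rightarrow> (real ^ 'n \<Rightarrow> real) \<Rightarrow> bool" where
  "hk_extremal \<xi> u \<longleftrightarrow> u \<in> admissible \<xi> \<and>
     (\<forall>\<phi>. smooth \<phi> \<and> zn_periodic \<phi> \<longrightarrow>
        ((\<lambda>t. hk_energy (\<lambda>y. u y + t * \<phi> y) \<xi>) has_real_derivative 0) (at 0))"

definition hk_minimum :: "(real ^ 'n \<Rightarrow> complex ^ 'n ^ 'n) \<Rightarrow> (real ^ 'n \<Rightarrow> real) \<Rightarrow> bool" where
  "hk_minimum \<xi> u \<longleftrightarrow> u \<in> admissible \<xi> \<and> (\<forall>v \<in> admissible \<xi>. hk_energy u \<xi> \<le> hk_energy v \<xi>)"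

text \<open>Definiteness of a tensor is a pointwise condition; the sign may depend on the point.\<close>

definition semidefinite_field :: "(real ^ 'n \<Rightarrow> real ^ 'n ^ 'n) \<Rightarrow> bool" where
  "semidefinite_field A \<longleftrightarrow> (\<forall>y. pos_semidefinite (A y) \<or> neg_semidefinite (A y))"

end

theory Submission
  imports Defs "HOL-Computational_Algebra.Fundamental_Theorem_Algebra"
begin

text \<open>
  Write $H = D^2u$ and $M = \xi H\bar\xi H$. On $[0,1)$ one has
  $f(x) = \log 2 - \frac1\pi\int_0^{\pi/2}\tan^2\theta\,\log(1 - x\cos^2\theta)\,d\theta$, so the energy
  density is, up to a constant, an average over $\theta$ of
  $-2\log\det H - \tan^2\theta\,\log\det(1 - \cos^2\theta\,M)$. Each of these functions is strictly convex
  in $H$. With $\alpha = \cos\theta$, $\hat H = \mathrm{diag}(H,H)$ and $V$ the real symmetric block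
  matrix of $\xi$, $\det(1-\alpha^2M) = \det(1+\alpha V\hat H)$, and $\mathrm{Tr}\,M < 1$ forces
  $-\hat H^{-1} < V < \hat H^{-1}$. The second variation of $-\log\det(1+\alpha V\hat H)$ is
  $\mathrm{Tr}(TKTK)$ with
  $-\frac{\alpha}{1-\alpha}\hat H^{-1} < T < \frac{\alpha}{1+\alpha}\hat H^{-1}$, hence exceeds
  $-\frac{\alpha^2}{1-\alpha^2}\mathrm{Tr}(\hat H^{-1}K\hat H^{-1}K)$, which is what $-\log\det$
  compensates. Semidefiniteness of the real and imaginary parts of $\xi$ only serves to make the set of
  admissible potentials convex. The energy is thus convex on segments, so critical points are minima;
  two minima have equal Hessians almost everywhere on the cube, hence differ by a periodic function with
  zero Hessian.
\<close>

subsection \<open>Positive semidefinite matrices\<close>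

text \<open>The obstacle is that the energy sums a function over the eigenvalues of a non-symmetric
  matrix that is nonlinear in H, and eigenvalues need not vary smoothly. Determinants avoid this.
  The doubling makes the argument of the determinant affine in H, so along a segment of Hessians the
  derivatives of its logarithm are explicit traces; the same determinants give measurability of the
  density in y. Doubling is natural because \<xi> acts as the conjugate-linear map z -> \<xi> conj
  z. This map is only real-linear, hence needs 2n real coordinates, and composing it with itself is
  complex-linear, whence the square of \<alpha>. The formula for f comes from differentiating in x:
  f'(x) = 1/(2(1 + sqrt(1-x))) is 1/pi times the integral of sin^2/(1 - x cos^2) over a quarter
  period. Its weight tan^2 is the reciprocal of \<alpha>^2/(1-\<alpha>^2), so the amount of -log det
  H required for compensation is the same for every \<theta>.\<close>

lemma psd_rank_one_decomposition:
  fixes A :: "real ^ 'm ^ 'm"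
  assumes "finite S" "pos_semidefinite A" "\<And>i j. i \<notin> S \<Longrightarrow> A $ i $ j = 0"
  shows "\<exists>c :: 'm \<Rightarrow> real ^ 'm. \<forall>i j. A $ i $ j = (\<Sum>k\<in>S. c k $ i * c k $ j)"
  using assms
\<comment> \<open>This is Cholesky elimination. The set S holds the indices whose rows may still be
  nonzero, so that one pivot at a time can be removed while the matrix type stays fixed.\<close>
proof (induction S arbitrary: A rule: finite_induct)
  case empty
  then show ?case by auto
next
  case (insert s S)
  have sym: "A $ i $ j = A $ j $ i" for i j
  proof -
    have "transpose A = A" using insert.prems(1) by (simp add: pos_semidefinite_def)
    then have "transpose A $ j $ i = A $ j $ i" by simp
    then show ?thesis by (simp add: transpose_def)
  qed
  have psd: "x \<bullet> (A *v x) \<ge> 0" for x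
    using insert.prems(1) by (simp add: pos_semidefinite_def)
  define a where "a = A *v axis s 1"
  have a: "a $ i = A $ i $ s" for i
    by (simp add: a_def matrix_vector_mult_basis column_def)
  have symv: "y \<bullet> (A *v x) = x \<bullet> (A *v y)" for x y
    using insert.prems(1) by (metis dot_lmul_matrix inner_commute pos_semidefinite_def transpose_matrix_vector)
  have ax: "axis s 1 \<bullet> (A *v x) = a \<bullet> x" for x
    using symv[of "axis s 1" x] by (simp add: a_def inner_commute)
  have ass: "axis s 1 \<bullet> (A *v axis s 1) = A $ s $ s"
    by (simp add: a ax inner_axis)
  have quad: "0 \<le> x \<bullet> (A *v x) + 2 * t * (a \<bullet> x) + t\<^sup>2 * A $ s $ s" for x t
  proof -
    have "0 \<le> (x + t *\<^sub>R axis s 1) \<bullet> (A *v (x + t *\<^sub>R axis s 1))" by (rule psd)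
    also have "\<dots> = x \<bullet> (A *v x) + 2 * t * (a \<bullet> x) + t\<^sup>2 * A $ s $ s"
      using ax ass symv[of "axis s 1" x] ax[of x]
      by (simp add: matrix_vector_right_distrib matrix_vector_mult_scaleR inner_add power2_eq_square
          algebra_simps)
    finally show ?thesis .
  qed
  show ?case
  proof (cases "A $ s $ s = 0")
    case True
    have "A $ s $ j = 0" for j
    proof (rule ccontr)
      assume n: "A $ s $ j \<noteq> 0"
      have "a \<bullet> axis j 1 = A $ s $ j" by (simp add: inner_axis a sym)
      \<comment> \<open>With a zero pivot the quadratic in t is affine. Its slope is nonzero, and
        this t gives it the value -1.\<close>
      with quad[of "axis j 1" "- ((axis j 1 \<bullet> (A *v axis j 1)) + 1) / (2 * A $ s $ j)"] True n
      show False by (simp add: field_simps)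
    qed
    then obtain c where c: "\<forall>i j. A $ i $ j = (\<Sum>k\<in>S. c k $ i * c k $ j)"
      using insert.IH[OF insert.prems(1)] insert.prems(2) by (metis insert_iff)
    show ?thesis
      using insert.hyps by (intro exI[of _ "c(s := 0)"]) (auto simp: c intro!: sum.cong)
  next
    case False
    then have pos: "A $ s $ s > 0" using psd[of "axis s 1"] ass by simp
    \<comment> \<open>The Schur complement of the pivot. Its form at x is the minimum over t of
      \<open>quad\<close>, attained at t = -(a . x)/A_ss.\<close>
    define B :: "real ^ 'm ^ 'm" where "B = (\<chi> i j. A $ i $ j - a $ i * a $ j / A $ s $ s)"
    have Bv: "B *v x = A *v x - ((a \<bullet> x) / A $ s $ s) *\<^sub>R a" for x
      by (simp add: B_def vec_eq_iff matrix_vector_mult_def inner_vec_def sum_subtractf sum_divide_distrib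
            sum_distrib_right sum_distrib_left algebra_simps)
    have "x \<bullet> (B *v x) \<ge> 0" for x
      using quad[of x "- (a \<bullet> x) / A $ s $ s"] pos
      by (simp add: Bv inner_diff_right inner_commute power2_eq_square field_simps)
    moreover have "transpose B = B"
      unfolding transpose_def B_def vec_eq_iff vec_lambda_beta by (metis sym mult.commute)
    ultimately have "pos_semidefinite B" by (simp add: pos_semidefinite_def)
    moreover have "B $ i $ j = 0" if "i \<notin> S" for i j
      using that insert.prems(2)[of i] False by (cases "i = s") (auto simp: B_def a sym[of j s])
    ultimately obtain c where c: "\<forall>i j. B $ i $ j = (\<Sum>k\<in>S. c k $ i * c k $ j)"
      using insert.IH[of B] by blast
    define c' where "c' = c(s := (1 / sqrt (A $ s $ s)) *\<^sub>R a)"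
    have "A $ i $ j = (\<Sum>k\<in>insert s S. c' k $ i * c' k $ j)" for i j
    proof -
      have "(\<Sum>k\<in>S. c' k $ i * c' k $ j) = (\<Sum>k\<in>S. c k $ i * c k $ j)"
        using insert.hyps by (intro sum.cong) (auto simp: c'_def)
      moreover have "c' s $ i * c' s $ j = a $ i * a $ j / A $ s $ s"
        using pos by (simp add: c'_def)
      ultimately show ?thesis
        using insert.hyps c[rule_format, of i j] by (simp add: B_def)
    qed
    then show ?thesis by blast
  qed
qed

text \<open>The Gram factor does the work of a square root of A without any spectral
  theorem.\<close>

lemma psd_gram:
  fixes A :: "real ^ 'm ^ 'm"
  assumes "pos_semidefinite A"
  shows "\<exists>C :: real ^ 'm ^ 'm. A = C ** transpose C"
proof -
  obtain c :: "'m \<Rightarrow> real ^ 'm" where c: "\<forall>i j. A $ i $ j = (\<Sum>k\<in>UNIV. c k $ i * c k $ j)"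
    using psd_rank_one_decomposition[of UNIV A] assms by auto
  have "A = (\<chi> i k. c k $ i) ** transpose (\<chi> i k. c k $ i)"
    by (simp add: vec_eq_iff matrix_matrix_mult_def transpose_def c)
  then show ?thesis by blast
qed

lemma trace_mult_transpose_eq_sum_squares:
  fixes L :: "real ^ 'm ^ 'm"
  shows "trace (L ** transpose L) = (\<Sum>i\<in>UNIV. \<Sum>j\<in>UNIV. (L $ i $ j)\<^sup>2)"
  by (simp add: trace_def matrix_matrix_mult_def transpose_def power2_eq_square)

text \<open>Cyclicity moves one factor C to the other end and leaves the trace of the square of the
  symmetric matrix \<open>L\<close>. All positivity of second variations rests on this.\<close>

lemma trace_psd_square:
  fixes C K :: "real ^ 'm ^ 'm"
  assumes "transpose K = K"
  defines "L \<equiv> transpose C ** K ** C"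
  shows "trace ((C ** transpose C) ** K ** (C ** transpose C) ** K) = (\<Sum>i\<in>UNIV. \<Sum>j\<in>UNIV. (L $ i $ j)\<^sup>2)"
proof -
  have "transpose L = L"
    by (simp add: L_def matrix_transpose_mul assms matrix_mul_assoc)
  moreover have "trace ((C ** transpose C) ** K ** (C ** transpose C) ** K) = trace (L ** L)"
    using trace_mul_sym[of C "transpose C ** K ** C ** transpose C ** K"]
    by (simp add: L_def matrix_mul_assoc)
  ultimately show ?thesis using trace_mult_transpose_eq_sum_squares[of L] by simp
qed

lemma trace_psd_nonneg:
  fixes A K :: "real ^ 'm ^ 'm"
  assumes "pos_semidefinite A" "transpose K = K"
  shows "trace (A ** K ** A ** K) \<ge> 0"
proof -
  obtain C :: "real ^ 'm ^ 'm" where A: "A = C ** transpose C" using psd_gram[OF assms(1)] by blast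
  show ?thesis
    unfolding A trace_psd_square[OF assms(2)] by (intro sum_nonneg) auto
qed

lemma pos_definite_imp_semidefinite: "pos_definite A \<Longrightarrow> pos_semidefinite A"
  unfolding pos_definite_def pos_semidefinite_def
  by (metis inner_zero_left less_eq_real_def)

lemma pos_definite_invertible:
  fixes A :: "real ^ 'm ^ 'm"
  assumes "pos_definite A"
  shows "invertible A"
proof -
  have "\<forall>x. A *v x = 0 \<longrightarrow> x = 0"
    using assms unfolding pos_definite_def by (metis inner_zero_right less_irrefl)
  then show ?thesis
    using invertible_left_inverse matrix_left_invertible_ker by blast
qed

lemma pos_definite_det_pos:
  fixes A :: "real ^ 'm ^ 'm"
  assumes "pos_definite A"
  shows "det A > 0"
proof -
  obtain C :: "real ^ 'm ^ 'm" where A: "A = C ** transpose C"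
    using psd_gram[OF pos_definite_imp_semidefinite[OF assms]] by blast
  have "det A \<noteq> 0" using pos_definite_invertible[OF assms] invertible_det_nz by blast
  moreover have "det A = (det C)\<^sup>2" by (simp add: A det_mul power2_eq_square)
  ultimately show ?thesis by simp
qed

lemma trace_pd_pos:
  fixes A K :: "real ^ 'm ^ 'm"
  assumes "pos_definite A" "transpose K = K" "K \<noteq> 0"
  shows "trace (A ** K ** A ** K) > 0"
proof -
  obtain C :: "real ^ 'm ^ 'm" where A: "A = C ** transpose C"
    using psd_gram[OF pos_definite_imp_semidefinite[OF assms(1)]] by blast
  define L where "L = transpose C ** K ** C"
  have tr: "trace (A ** K ** A ** K) = (\<Sum>i\<in>UNIV. \<Sum>j\<in>UNIV. (L $ i $ j)\<^sup>2)"
    unfolding A L_def by (rule trace_psd_square) fact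
  have "trace (A ** K ** A ** K) \<noteq> 0"
  proof
    assume "trace (A ** K ** A ** K) = 0"
    then have "L = 0"
      unfolding tr by (simp add: sum_nonneg_eq_0_iff sum_nonneg vec_eq_iff)
    \<comment> \<open>A K A is C L C^T, so it vanishes with L; invertibility of A then removes the
      outer factors.\<close>
    then have "A ** K ** A = 0"
      using matrix_mul_assoc by (metis A L_def matrix_mul_assoc vec_eq_iff zero_index times0_left times0_right)
    moreover obtain B where "B ** A = mat 1" "A ** B = mat 1"
      using pos_definite_invertible[OF assms(1)] invertible_def by blast
    ultimately have "K = 0"
      by (metis matrix_mul_assoc matrix_mul_lid matrix_mul_rid times0_left times0_right)
    with assms(3) show False by simp
  qed
  then show ?thesis
    using trace_psd_nonneg[OF pos_definite_imp_semidefinite[OF assms(1)] assms(2)] by simp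
qed

subsection \<open>Eigenvalues of the Higgs matrix\<close>

abbreviation cmat :: "real ^ 'm ^ 'n \<Rightarrow> complex ^ 'm ^ 'n" where
  "cmat \<equiv> map_matrix complex_of_real"

lemma cmat_mult: "cmat (A ** B) = cmat A ** cmat B"
  by (simp add: vec_eq_iff matrix_matrix_mult_def)

lemma cmat_transpose: "transpose (cmat A) = cmat (transpose A)"
  by (simp add: vec_eq_iff transpose_def)

lemma det_cmat: "det (cmat A) = complex_of_real (det A)"
  by (simp add: det_def)

lemma cnj_mult_matrix:
  "map_matrix cnj (A ** B) = map_matrix cnj A ** map_matrix cnj B"
  by (simp add: vec_eq_iff matrix_matrix_mult_def)

lemma sum_mult_matrix_vector:
  fixes A :: "'a::comm_semiring_1 ^ 'm ^ 'n"
  shows "(\<Sum>i\<in>UNIV. x $ i * (A *v y) $ i) = (\<Sum>j\<in>UNIV. (transpose A *v x) $ j * y $ j)"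
  unfolding matrix_vector_mult_def transpose_def vec_lambda_beta sum_distrib_left sum_distrib_right
  by (subst sum.swap) (simp add: mult_ac)

lemma norm_sum_mult_square_le:
  fixes x y :: "'i \<Rightarrow> complex"
  shows "(norm (\<Sum>i\<in>S. x i * y i))\<^sup>2 \<le> (\<Sum>i\<in>S. (norm (x i))\<^sup>2) * (\<Sum>i\<in>S. (norm (y i))\<^sup>2)"
proof -
  have "norm (\<Sum>i\<in>S. x i * y i) \<le> (\<Sum>i\<in>S. norm (x i) * norm (y i))"
    by (rule order_trans[OF norm_sum]) (simp add: norm_mult)
  then have "(norm (\<Sum>i\<in>S. x i * y i))\<^sup>2 \<le> (\<Sum>i\<in>S. norm (x i) * norm (y i))\<^sup>2"
    by (rule power_mono) simp
  also have "\<dots> \<le> (\<Sum>i\<in>S. (norm (x i))\<^sup>2) * (\<Sum>i\<in>S. (norm (y i))\<^sup>2)"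
    by (rule Cauchy_Schwarz_ineq_sum)
  finally show ?thesis .
qed

section \<open>Hermitian forms and the location of the eigenvalues\<close>

definition herm_form :: "real ^ 'n ^ 'n \<Rightarrow> complex ^ 'n \<Rightarrow> real" where
  "herm_form H a = Re (\<Sum>i\<in>UNIV. cnj (a $ i) * (cmat H *v a) $ i)"

lemma herm_form_gram:
  fixes C :: "real ^ 'n ^ 'n"
  assumes "H = C ** transpose C"
  shows "(\<Sum>i\<in>UNIV. cnj (a $ i) * (cmat H *v a) $ i) =
    complex_of_real (\<Sum>k\<in>UNIV. (norm ((transpose (cmat C) *v a) $ k))\<^sup>2)"
proof -
  have "(\<Sum>i\<in>UNIV. cnj (a $ i) * (cmat H *v a) $ i) =
     (\<Sum>i\<in>UNIV. (\<chi> i. cnj (a $ i)) $ i * (cmat C *v (transpose (cmat C) *v a)) $ i)"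
    by (simp add: assms cmat_mult cmat_transpose matrix_vector_mul_assoc)
  also have "\<dots> = (\<Sum>k\<in>UNIV. (transpose (cmat C) *v (\<chi> i. cnj (a $ i))) $ k * (transpose (cmat C) *v a) $ k)"
    by (rule sum_mult_matrix_vector)
  also have "\<dots> = (\<Sum>k\<in>UNIV. cnj ((transpose (cmat C) *v a) $ k) * (transpose (cmat C) *v a) $ k)"
    by (simp add: matrix_vector_mult_def transpose_def)
  also have "\<dots> = complex_of_real (\<Sum>k\<in>UNIV. (norm ((transpose (cmat C) *v a) $ k))\<^sup>2)"
    by (simp add: complex_norm_square mult.commute del: of_real_power)
  finally show ?thesis .
qed

lemma herm_form_complex:
  fixes H :: "real ^ 'n ^ 'n"
  assumes "pos_semidefinite H"
  shows "(\<Sum>i\<in>UNIV. cnj (a $ i) * (cmat H *v a) $ i) = complex_of_real (herm_form H a)"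
    and "herm_form H a \<ge> 0"
proof -
  obtain C :: "real ^ 'n ^ 'n" where C: "H = C ** transpose C" using psd_gram[OF assms] by blast
  note * = herm_form_gram[OF C, of a]
  show "(\<Sum>i\<in>UNIV. cnj (a $ i) * (cmat H *v a) $ i) = complex_of_real (herm_form H a)"
    unfolding herm_form_def * by simp
  show "herm_form H a \<ge> 0"
    unfolding herm_form_def * by (simp add: sum_nonneg)
qed

lemma herm_form_pos:
  fixes H :: "real ^ 'n ^ 'n"
  assumes "pos_definite H" "a \<noteq> 0"
  shows "herm_form H a > 0"
proof -
  obtain C :: "real ^ 'n ^ 'n" where C: "H = C ** transpose C"
    using psd_gram[OF pos_definite_imp_semidefinite[OF assms(1)]] by blast
  have eq: "herm_form H a = (\<Sum>k\<in>UNIV. (norm ((transpose (cmat C) *v a) $ k))\<^sup>2)"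
    unfolding herm_form_def herm_form_gram[OF C, of a] by simp
  have "herm_form H a \<noteq> 0"
  proof
    assume "herm_form H a = 0"
    then have "transpose (cmat C) *v a = 0"
      unfolding eq by (simp add: sum_nonneg_eq_0_iff vec_eq_iff)
    then have "cmat H *v a = 0"
      by (simp add: C cmat_mult cmat_transpose flip: matrix_vector_mul_assoc)
    moreover have "invertible (cmat H)"
      using pos_definite_det_pos[OF assms(1)] by (simp add: invertible_det_nz det_cmat)
    ultimately show False
      using assms(2) invertible_left_inverse matrix_left_invertible_ker by blast
  qed
  then show ?thesis
    using herm_form_complex(2)[OF pos_definite_imp_semidefinite[OF assms(1)], of a] by linarith
qed

lemma herm_form_cnj: "herm_form H (\<chi> i. cnj (a $ i)) = herm_form H a"
proof -
  have "(\<Sum>i\<in>UNIV. a $ i * (cmat H *v (\<chi> i. cnj (a $ i))) $ i) = cnj (\<Sum>i\<in>UNIV. cnj (a $ i) * (cmat H *v a) $ i)"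
    by (simp add: matrix_vector_mult_def)
  then show ?thesis by (simp add: herm_form_def)
qed

text \<open>Writing H = T^T T with T real and N = T \<xi> T^T, the bilinear expression is (Ta)^T N
  (Tb), and the trace is the squared Frobenius norm of N because N is symmetric. The inequality is
  then the bound of the operator norm by the Frobenius norm. It is the way in which Tr M < 1 enters
  all later estimates.\<close>

lemma norm_bilinear_le_trace:
  fixes \<xi> :: "complex ^ 'n ^ 'n"
  assumes "pos_semidefinite H" "transpose \<xi> = \<xi>"
  shows "(norm (\<Sum>i\<in>UNIV. a $ i * ((cmat H ** \<xi> ** cmat H) *v b) $ i))\<^sup>2
    \<le> herm_form H a * herm_form H b * Re (trace (\<xi> ** cmat H ** map_matrix cnj \<xi> ** cmat H))"
proof -
  obtain C :: "real ^ 'n ^ 'n" where C: "H = C ** transpose C" using psd_gram[OF assms(1)] by blast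
  define T where "T = transpose (cmat C)"
  have H: "cmat H = transpose T ** T" by (simp add: C cmat_mult T_def cmat_transpose)
  define N where "N = T ** \<xi> ** transpose T"
  have form: "herm_form H a = (\<Sum>k\<in>UNIV. (norm ((T *v a) $ k))\<^sup>2)" for a
    unfolding herm_form_def herm_form_gram[OF C] T_def by simp
  have "transpose N = N"
    by (simp add: N_def matrix_transpose_mul assms(2) matrix_mul_assoc)
  then have symN: "N $ i $ j = N $ j $ i" for i j
    by (metis transpose_def vec_lambda_beta)
  have "map_matrix cnj N = T ** map_matrix cnj \<xi> ** transpose T"
  proof -
    have "map_matrix cnj T = T" "map_matrix cnj (transpose T) = transpose T"
      by (simp_all add: T_def vec_eq_iff transpose_def)
    then show ?thesis by (simp only: N_def cnj_mult_matrix)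
  qed
  then have "trace (\<xi> ** cmat H ** map_matrix cnj \<xi> ** cmat H) = trace (N ** map_matrix cnj N)"
    using trace_mul_sym[of "\<xi> ** transpose T ** T ** map_matrix cnj \<xi> ** transpose T" T]
    by (simp add: H N_def matrix_mul_assoc)
  also have "\<dots> = complex_of_real (\<Sum>i\<in>UNIV. \<Sum>j\<in>UNIV. (norm (N $ i $ j))\<^sup>2)"
    unfolding trace_def matrix_matrix_mult_def
    by (simp add: complex_norm_square symN[of _ _] del: of_real_power)
  finally have tr: "Re (trace (\<xi> ** cmat H ** map_matrix cnj \<xi> ** cmat H)) =
      (\<Sum>i\<in>UNIV. \<Sum>j\<in>UNIV. (norm (N $ i $ j))\<^sup>2)" by simp
  have "(\<Sum>i\<in>UNIV. a $ i * ((cmat H ** \<xi> ** cmat H) *v b) $ i) = (\<Sum>i\<in>UNIV. a $ i * (transpose T *v (N *v (T *v b))) $ i)"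
    by (simp add: H N_def matrix_vector_mul_assoc matrix_mul_assoc)
  also have "\<dots> = (\<Sum>k\<in>UNIV. (T *v a) $ k * (N *v (T *v b)) $ k)"
    by (subst sum_mult_matrix_vector) simp
  finally have "(norm (\<Sum>i\<in>UNIV. a $ i * ((cmat H ** \<xi> ** cmat H) *v b) $ i))\<^sup>2
      \<le> herm_form H a * (\<Sum>k\<in>UNIV. (norm ((N *v (T *v b)) $ k))\<^sup>2)"
    unfolding form by (simp add: norm_sum_mult_square_le)
  moreover have "(\<Sum>k\<in>UNIV. (norm ((N *v (T *v b)) $ k))\<^sup>2) \<le>
      (\<Sum>k\<in>UNIV. (\<Sum>j\<in>UNIV. (norm (N $ k $ j))\<^sup>2) * herm_form H b)"
    unfolding form by (intro sum_mono) (simp add: matrix_vector_mult_def norm_sum_mult_square_le)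
  ultimately have "(norm (\<Sum>i\<in>UNIV. a $ i * ((cmat H ** \<xi> ** cmat H) *v b) $ i))\<^sup>2
      \<le> herm_form H a * (\<Sum>k\<in>UNIV. (\<Sum>j\<in>UNIV. (norm (N $ k $ j))\<^sup>2) * herm_form H b)"
    using herm_form_complex(2)[OF assms(1), of a] by (meson mult_left_mono order_trans)
  then show ?thesis
    unfolding tr sum_distrib_right[symmetric] by (simp add: mult_ac)
qed

text \<open>With w = conj \<xi> H v, pairing d v = \<xi> H w with H v gives d h(v) = h(w), where h
  is \<open>herm_form H\<close>; hence d is real and nonnegative. The trace bound applied to the
  same pairing gives d^2 h(v)^2 <= h(v) h(w) Tr M = d h(v)^2 Tr M, hence d <= Tr M for d > 0. No
  diagonalization is involved.\<close>

lemma eigenvalue_range: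
  fixes \<xi> :: "complex ^ 'n ^ 'n"
  assumes H: "pos_definite H" and sym: "transpose \<xi> = \<xi>"
    and tr: "Re (trace (\<xi> ** cmat H ** map_matrix cnj \<xi> ** cmat H)) < 1"
    and ev: "(\<xi> ** cmat H ** map_matrix cnj \<xi> ** cmat H) *v v = d *s v" "v \<noteq> 0"
  obtains r where "d = complex_of_real r" "0 \<le> r" "r < 1"
proof -
  let ?c = "\<lambda>x :: complex ^ 'n. \<chi> i. cnj (x $ i)"
  define w where "w = map_matrix cnj \<xi> *v (cmat H *v v)"
  have symH: "transpose (cmat H) = cmat H"
    using H by (simp add: cmat_transpose pos_definite_def)
  note psd = pos_definite_imp_semidefinite[OF H]
  have dv: "d *s v = \<xi> *v (cmat H *v w)"
    by (simp add: w_def matrix_vector_mul_assoc matrix_mul_assoc flip: ev)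
  have cw: "?c w = \<xi> *v (cmat H *v ?c v)"
    by (simp add: w_def matrix_vector_mult_def vec_eq_iff)
  have "d * complex_of_real (herm_form H v) = (\<Sum>i\<in>UNIV. ?c v $ i * (cmat H *v (d *s v)) $ i)"
    unfolding herm_form_complex(1)[OF psd, symmetric]
    by (simp add: sum_distrib_left matrix_vector_mult_def sum_distrib_right mult_ac)
  also have "\<dots> = (\<Sum>i\<in>UNIV. ?c v $ i * ((cmat H ** \<xi> ** cmat H) *v w) $ i)"
    by (simp add: dv matrix_vector_mul_assoc matrix_mul_assoc)
  finally have e1: "d * complex_of_real (herm_form H v) = (\<Sum>i\<in>UNIV. ?c v $ i * ((cmat H ** \<xi> ** cmat H) *v w) $ i)" .
  also have "\<dots> = (\<Sum>i\<in>UNIV. ?c v $ i * ((cmat H ** \<xi>) *v (cmat H *v w)) $ i)"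
    by (simp add: matrix_vector_mul_assoc)
  also have "\<dots> = (\<Sum>i\<in>UNIV. ?c w $ i * (cmat H *v w) $ i)"
    by (subst sum_mult_matrix_vector) (simp add: matrix_transpose_mul sym symH cw matrix_vector_mul_assoc)
  also have "\<dots> = complex_of_real (herm_form H w)"
    using herm_form_complex(1)[OF psd, of w] by simp
  finally have e2: "d * complex_of_real (herm_form H v) = complex_of_real (herm_form H w)" .
  have pos: "herm_form H v > 0" by (rule herm_form_pos[OF H ev(2)])
  define r where "r = herm_form H w / herm_form H v"
  have d: "d = complex_of_real r"
    using e2 pos by (simp add: r_def field_simps)
  have r0: "r \<ge> 0" using pos herm_form_complex(2)[OF psd, of w] by (simp add: r_def)
  have hw: "herm_form H w = r * herm_form H v" using pos by (simp add: r_def)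
  have "(norm (d * complex_of_real (herm_form H v)))\<^sup>2 \<le> herm_form H v * herm_form H w *
      Re (trace (\<xi> ** cmat H ** map_matrix cnj \<xi> ** cmat H))"
    unfolding e1 using norm_bilinear_le_trace[OF psd sym, of "?c v" w] by (simp add: herm_form_cnj)
  then have le: "r * (r * (herm_form H v)\<^sup>2) \<le> r * (herm_form H v)\<^sup>2 * Re (trace (\<xi> ** cmat H ** map_matrix cnj \<xi> ** cmat H))"
    using pos r0 by (simp add: d hw norm_mult power2_eq_square mult_ac)
  have "r < 1"
  proof (cases "r = 0")
    case False
    then have "r * (herm_form H v)\<^sup>2 > 0" using r0 pos by simp
    moreover have "(r * (herm_form H v)\<^sup>2) * r \<le> (r * (herm_form H v)\<^sup>2) * Re (trace (\<xi> ** cmat H ** map_matrix cnj \<xi> ** cmat H))"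
      using le by (simp add: mult_ac)
    ultimately have "r \<le> Re (trace (\<xi> ** cmat H ** map_matrix cnj \<xi> ** cmat H))"
      using mult_le_cancel_left_pos by blast
    with tr show ?thesis by simp
  qed simp
  with d r0 show ?thesis by (rule that)
qed

section \<open>The characteristic polynomial and its roots\<close>

lemma coeff_prod_linear:
  fixes f :: "'i \<Rightarrow> 'a::comm_ring_1 poly"
  assumes "finite S" "\<And>i. i \<in> S \<Longrightarrow> degree (f i) \<le> 1"
  shows "coeff (prod f S) (card S) = (\<Prod>i\<in>S. coeff (f i) 1) \<and> degree (prod f S) \<le> card S"
  using assms
proof (induction S rule: finite_induct)
  case (insert x S)
  then have IH: "coeff (prod f S) (card S) = (\<Prod>i\<in>S. coeff (f i) 1)" "degree (prod f S) \<le> card S"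
    by auto
  obtain a b where fx: "f x = [:a, b:]"
    using insert.prems[of x] by (metis One_nat_def degree1_coeffs degree_0_id insertI1 le_Suc_eq le_zero_eq pCons_0_0)
  have z: "coeff (prod f S) (Suc (card S)) = 0"
    using IH(2) by (intro coeff_eq_0) simp
  have "degree (f x * prod f S) \<le> Suc (card S)"
    using degree_mult_le[of "f x" "prod f S"] insert.prems[of x] IH(2) by force
  then show ?case
    using insert.hyps IH(1) z by (simp add: fx)
qed simp

lemma poly_charpoly: "poly (charpoly A) z = det (mat z - A)"
  by (simp add: charpoly_def det_def poly_sum poly_prod mat_def if_distrib[of "\<lambda>p. poly p z"] of_int_poly cong: if_cong)

text \<open>Every entry of X - A has degree at most 1, and its coefficient of degree 1 is the
  corresponding entry of the identity. Taking the coefficient of degree n in each product of the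
  Leibniz formula therefore yields the determinant of the identity.\<close>

lemma charpoly_monic:
  fixes A :: "'a::idom ^ 'n ^ 'n"
  shows "degree (charpoly A) = CARD('n)" "lead_coeff (charpoly A) = 1"
proof -
  define B where "B = mat [:0, 1:] - map_matrix (\<lambda>a. [:a:]) A"
  have B: "B $ i $ j = (if i = j then [:- (A $ i $ j), 1:] else [:- (A $ i $ j):])" for i j
    by (simp add: B_def mat_def)
  have prod: "coeff (\<Prod>i\<in>UNIV. B $ i $ p i) CARD('n) = (\<Prod>i\<in>UNIV. (mat 1 :: 'a ^ 'n ^ 'n) $ i $ p i) \<and>
      degree (\<Prod>i\<in>UNIV. B $ i $ p i) \<le> CARD('n)" for p
    using coeff_prod_linear[of "UNIV :: 'n set" "\<lambda>i. B $ i $ p i"]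
    by (simp add: B mat_def if_distrib[of "\<lambda>p. coeff p _"] cong: if_cong)
  have cp: "charpoly A = (\<Sum>p\<in>{p. p permutes UNIV}. of_int (sign p) * (\<Prod>i\<in>UNIV. B $ i $ p i))"
    by (simp add: charpoly_def B_def det_def)
  have "coeff (charpoly A) CARD('n) = det (mat 1 :: 'a ^ 'n ^ 'n)"
    unfolding cp det_def coeff_sum using prod by (simp add: of_int_poly)
  then have c: "coeff (charpoly A) CARD('n) = 1" by simp
  have "degree (charpoly A) \<le> CARD('n)"
    unfolding cp using prod
    by (intro degree_sum_le) (auto simp: of_int_poly intro: order_trans[OF degree_smult_le])
  moreover have "degree (charpoly A) \<ge> CARD('n)" using c by (intro le_degree) simp
  ultimately show "degree (charpoly A) = CARD('n)" by simp
  with c show "lead_coeff (charpoly A) = 1" by simp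
qed

lemma size_eigenvalues: "size (eigenvalues (A :: complex ^ 'n ^ 'n)) = CARD('n)"
  by (simp add: eigenvalues_def size_proots_complex charpoly_monic)

lemma eigenvalue_vector:
  fixes A :: "complex ^ 'n ^ 'n"
  assumes "d \<in># eigenvalues A"
  obtains v where "A *v v = d *s v" "v \<noteq> 0"
proof -
  have "charpoly A \<noteq> 0" using charpoly_monic(2)[of A] by auto
  then have "poly (charpoly A) d = 0" using assms by (simp add: eigenvalues_def)
  then have "\<not> invertible (mat d - A)" by (simp add: poly_charpoly invertible_det_nz)
  then obtain v where v: "(mat d - A) *v v = 0" "v \<noteq> 0"
    using invertible_left_inverse matrix_left_invertible_ker by blast
  have "mat d *v v = d *s v"
    by (simp add: vec_eq_iff matrix_vector_mult_def mat_def if_distrib[of "\<lambda>x. x * _"] cong: if_cong)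
  with v show ?thesis by (intro that[of v]) (auto simp: matrix_vector_mult_diff_rdistrib)
qed

lemma det_scaleR: 
  fixes A :: "complex ^ 'n ^ 'n"
  shows "det (c *\<^sub>R A) = complex_of_real c ^ CARD('n) * det A"
  unfolding det_def sum_distrib_left
  by (simp add: scaleR_conv_of_real[where 'a = complex] prod.distrib mult_ac)

text \<open>The bridge from the eigenvalue multiset to determinants: for c nonzero the left side is
  c^n times the characteristic polynomial at 1/c, which splits over the complex numbers into exactly
  n linear factors.\<close>

lemma det_one_minus_eigenvalues:
  fixes A :: "complex ^ 'n ^ 'n"
  shows "det (mat 1 - c *\<^sub>R A) = (\<Prod>d\<in>#eigenvalues A. 1 - complex_of_real c * d)"
proof (cases "c = 0")
  case False
  have "mat 1 - c *\<^sub>R A = c *\<^sub>R (mat (1 / complex_of_real c) - A)"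
    using False by (simp add: vec_eq_iff mat_def scaleR_conv_of_real[where 'a = complex] right_diff_distrib)
  then have "det (mat 1 - c *\<^sub>R A) = complex_of_real c ^ CARD('n) * poly (charpoly A) (1 / complex_of_real c)"
    by (simp add: det_scaleR poly_charpoly)
  also have "charpoly A = (\<Prod>d\<in>#eigenvalues A. [:- d, 1:])"
    using complex_poly_decompose_multiset[of "charpoly A"]
    unfolding charpoly_monic(2) eigenvalues_def by simp
  also have "poly \<dots> (1 / complex_of_real c) = (\<Prod>d\<in>#eigenvalues A. 1 / complex_of_real c - d)"
    by (simp add: poly_prod_mset image_mset.compositionality o_def)
  also have "complex_of_real c ^ CARD('n) * \<dots> = (\<Prod>d\<in>#eigenvalues A. complex_of_real c * (1 / complex_of_real c - d))"
    unfolding prod_mset.distrib by (simp add: size_eigenvalues[of A, symmetric])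
  also have "\<dots> = (\<Prod>d\<in>#eigenvalues A. 1 - complex_of_real c * d)"
    using False by (simp add: right_diff_distrib)
  finally show ?thesis .
qed simp

subsection \<open>Block matrices\<close>

definition block_matrix ::
    "'a ^ 'n ^ 'n \<Rightarrow> 'a ^ 'n ^ 'n \<Rightarrow> 'a ^ 'n ^ 'n \<Rightarrow> 'a ^ 'n ^ 'n \<Rightarrow> 'a ^ ('n + 'n) ^ ('n + 'n)" where
  "block_matrix A B C D = (\<chi> i j. case i of
      Inl a \<Rightarrow> (case j of Inl b \<Rightarrow> A $ a $ b | Inr b \<Rightarrow> B $ a $ b)
    | Inr a \<Rightarrow> (case j of Inl b \<Rightarrow> C $ a $ b | Inr b \<Rightarrow> D $ a $ b))"

lemma block_matrix_nth [simp]: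
  "block_matrix A B C D $ Inl a $ Inl b = A $ a $ b"
  "block_matrix A B C D $ Inl a $ Inr b = B $ a $ b"
  "block_matrix A B C D $ Inr a $ Inl b = C $ a $ b"
  "block_matrix A B C D $ Inr a $ Inr b = D $ a $ b"
  by (simp_all add: block_matrix_def)

lemma sum_UNIV_sum:
  fixes f :: "'n::finite + 'm::finite \<Rightarrow> 'b::comm_monoid_add"
  shows "sum f UNIV = (\<Sum>a\<in>UNIV. f (Inl a)) + (\<Sum>b\<in>UNIV. f (Inr b))"
  by (simp add: sum.Plus o_def flip: UNIV_Plus_UNIV)

lemma all_sum_type: "(\<forall>i :: 'n + 'm. P i) \<longleftrightarrow> (\<forall>a. P (Inl a)) \<and> (\<forall>b. P (Inr b))"
  by (metis sumE)

lemma block_matrix_eq_iff: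
  "X = block_matrix A B C D \<longleftrightarrow> (\<forall>a b. X $ Inl a $ Inl b = A $ a $ b \<and> X $ Inl a $ Inr b = B $ a $ b \<and>
     X $ Inr a $ Inl b = C $ a $ b \<and> X $ Inr a $ Inr b = D $ a $ b)"
  by (auto simp: vec_eq_iff all_sum_type)

lemma block_matrix_mult:
  "block_matrix A B C D ** block_matrix A' B' C' D' =
    block_matrix (A ** A' + B ** C') (A ** B' + B ** D') (C ** A' + D ** C') (C ** B' + D ** D')"
  by (simp add: block_matrix_eq_iff) (simp add: matrix_matrix_mult_def sum_UNIV_sum)

lemma transpose_block_matrix:
  "transpose (block_matrix A B C D) = block_matrix (transpose A) (transpose C) (transpose B) (transpose D)"
  by (simp add: block_matrix_eq_iff) (simp add: transpose_def)

lemma mat_block_matrix: "mat c = block_matrix (mat c) 0 0 (mat c)"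
  by (simp add: block_matrix_eq_iff mat_def)

text \<open>A permutation that moves some \<open>Inr\<close> index picks a zero entry from the
  identity block. The remaining permutations are those of the \<open>Inl\<close> indices, which
  correspond to permutations of the smaller index type with the same sign.\<close>

lemma det_block_matrix_one:
  fixes A :: "'a::comm_ring_1 ^ 'n ^ 'n"
  shows "det (block_matrix A 0 0 (mat 1)) = det A"
proof -
  define X where "X = block_matrix A 0 0 (mat 1)"
  define t where "t = (\<lambda>p. of_int (sign p) * (\<Prod>i\<in>UNIV. X $ i $ p i))"
  let ?m = "map_permutation UNIV (Inl :: 'n \<Rightarrow> 'n + 'n)"
  have bij: "bij_betw (Inl :: 'n \<Rightarrow> 'n + 'n) UNIV (range Inl)"
    by (simp add: bij_betw_def)
  have map_apply: "?m q (Inl a) = Inl (q a)" "?m q (Inr b) = Inr b" for q a b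
    by (auto simp: map_permutation_apply map_permutation_def restrict_id_def)
  have "det X = (\<Sum>p | p permutes UNIV. t p)"
    by (simp add: det_def t_def)
  also have "\<dots> = (\<Sum>p | p permutes range Inl. t p)"
  proof (rule sum.mono_neutral_right)
    show "{p. p permutes range Inl} \<subseteq> {p :: 'n + 'n \<Rightarrow> 'n + 'n. p permutes UNIV}"
      using permutes_subset by blast
    show "\<forall>p\<in>{p. p permutes UNIV} - {p. p permutes range Inl}. t p = 0"
    proof
      fix p :: "'n + 'n \<Rightarrow> 'n + 'n"
      assume p: "p \<in> {p. p permutes UNIV} - {p. p permutes range Inl}"
      have "\<exists>b. p (Inr b) \<noteq> Inr b"
      proof (rule ccontr)
        assume *: "\<nexists>b. p (Inr b) \<noteq> Inr b"
        have "p x = x" if "x \<in> UNIV - range Inl" for x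
          using that * by (cases x) auto
        then have "p permutes range Inl"
          using p permutes_superset[of p UNIV "range Inl"] by auto
        with p show False by simp
      qed
      then obtain b where b: "p (Inr b) \<noteq> Inr b" by blast
      have "X $ Inr b $ p (Inr b) = 0"
        using b by (cases "p (Inr b)") (auto simp: X_def mat_def)
      then have "(\<Prod>i\<in>UNIV. X $ i $ p i) = 0"
        by (intro prod_zero) auto
      then show "t p = 0" by (simp add: t_def)
    qed
  qed simp
  also have "\<dots> = (\<Sum>q | q permutes UNIV. t (?m q))"
  proof (rule sum.reindex_bij_betw[symmetric])
    have "?m = (\<lambda>q x. if x \<in> range Inl then Inl (q (inv_into UNIV Inl x)) else x)"
      by (intro ext) (auto simp: map_permutation_def restrict_id_def)
    then show "bij_betw ?m {q. q permutes UNIV} {p. p permutes range Inl}"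
      using bij_betw_permutations[OF bij] by simp
  qed
  also have "\<dots> = det A"
    unfolding det_def
  proof (rule sum.cong[OF refl])
    fix q :: "'n \<Rightarrow> 'n"
    assume "q \<in> {q. q permutes UNIV}"
    then have "sign (?m q) = sign q"
      by (intro sign_map_permutation) auto
    moreover have "(\<Prod>i\<in>UNIV. X $ i $ ?m q i) = (\<Prod>i\<in>UNIV. A $ i $ q i)"
      by (simp add: prod.Plus o_def map_apply X_def mat_def flip: UNIV_Plus_UNIV)
    ultimately show "t (?m q) = of_int (sign q) * (\<Prod>i\<in>UNIV. A $ i $ q i)"
      by (simp add: t_def)
  qed
  finally show ?thesis by (simp add: X_def)
qed

lemma det_mat: "det (mat c :: 'a::comm_ring_1 ^ 'n ^ 'n) = c ^ CARD('n)"
  by (subst det_diagonal) (auto simp: mat_def)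

lemma mat_mult: "mat c ** A = (\<chi> i j. c * A $ i $ j)"
  by (simp add: vec_eq_iff matrix_matrix_mult_def mat_def if_distrib[of "\<lambda>x. x * _"] cong: if_cong)

lemma mult_mat: "A ** mat c = (\<chi> i j. A $ i $ j * c)"
  by (simp add: vec_eq_iff matrix_matrix_mult_def mat_def if_distrib[of "\<lambda>x. _ * x"] cong: if_cong)

(* The transvection with entry 2B is both the square of the one with entry B and conjugate to it. *)
lemma det_block_upper_one:
  fixes B :: "'a::field_char_0 ^ 'n ^ 'n"
  shows "det (block_matrix (mat 1) B 0 (mat 1)) = 1"
proof -
  let ?U = "\<lambda>B :: 'a ^ 'n ^ 'n. block_matrix (mat 1) B 0 (mat 1)"
  let ?D = "block_matrix (mat 2) 0 0 (mat 1) :: 'a ^ ('n + 'n) ^ ('n + 'n)"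
  have mul: "?U B ** ?U C = ?U (B + C)" for B C
    by (simp add: block_matrix_mult add.commute)
  have "?D ** ?U B = ?U (B + B) ** ?D"
    by (simp add: block_matrix_mult mat_mult block_matrix_eq_iff)
  then have "det ?D * det (?U B) = det (?U (B + B)) * det ?D"
    by (metis det_mul)
  moreover have "det ?D \<noteq> 0"
    by (simp add: det_block_matrix_one det_mat)
  ultimately have "det (?U B) = det (?U (B + B))" by simp
  also have "\<dots> = det (?U B) * det (?U B)" by (metis det_mul mul)
  finally have "det (?U B) = det (?U B) * det (?U B)" .
  moreover have "det (?U B) * det (?U (- B)) = 1"
    by (metis add.right_inverse det_I det_mul mat_block_matrix mul)
  ultimately show ?thesis by (metis mult_cancel_left2 mult_zero_left zero_neq_one)
qed

text \<open>Block elimination: upper unitriangular times block diagonal times lower unitriangular,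
  with Schur complement 1 - BC.\<close>

lemma det_block_schur:
  fixes B :: "'a::field_char_0 ^ 'n ^ 'n"
  shows "det (block_matrix (mat 1) B C (mat 1)) = det (mat 1 - B ** C)"
proof -
  have "block_matrix (mat 1) B C (mat 1) = block_matrix (mat 1) B 0 (mat 1) **
      (block_matrix (mat 1 - B ** C) 0 0 (mat 1) ** block_matrix (mat 1) 0 C (mat 1))"
    by (simp add: block_matrix_mult)
  moreover have "det (block_matrix (mat 1) 0 C (mat 1)) = 1"
    using det_transpose[of "block_matrix (mat 1) 0 C (mat 1)"] det_block_upper_one[of "transpose C"]
    by (simp add: transpose_block_matrix transpose_mat) (simp add: transpose_def vec_eq_iff zero_vec_def)
  ultimately show ?thesis by (simp add: det_mul det_block_upper_one det_block_matrix_one)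
qed

definition diag_block :: "'a::zero ^ 'n ^ 'n \<Rightarrow> 'a ^ ('n + 'n) ^ ('n + 'n)" where
  "diag_block H = block_matrix H 0 0 H"

lemma det_diag_block:
  fixes H :: "'a::comm_ring_1 ^ 'n ^ 'n"
  shows "det (diag_block H) = (det H)\<^sup>2"
proof -
  \<comment> \<open>The swap of the two blocks is an involution, so its determinant enters only
    through that of its square.\<close>
  define S where "S = (block_matrix 0 (mat 1) (mat 1) 0 :: 'a ^ ('n + 'n) ^ ('n + 'n))"
  have "block_matrix (mat 1) 0 0 H = S ** block_matrix H 0 0 (mat 1) ** S"
    by (simp add: block_matrix_mult S_def)
  then have "det (block_matrix (mat 1) 0 0 H) = det (S ** S) * det (block_matrix H 0 0 (mat 1))"
    by (simp add: det_mul mult_ac)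
  also have "S ** S = mat 1"
    by (simp add: block_matrix_mult mat_block_matrix S_def)
  finally have "det (block_matrix (mat 1) 0 0 H) = det H" by (simp add: det_block_matrix_one)
  moreover have "diag_block H = block_matrix H 0 0 (mat 1) ** block_matrix (mat 1) 0 0 H"
    by (simp add: block_matrix_mult diag_block_def)
  ultimately show ?thesis by (simp add: det_mul det_block_matrix_one power2_eq_square)
qed

text \<open>In real coordinates z = p + iq this is the matrix of z -> \<xi> conj z. For symmetric
  \<xi> it is also the Gram matrix of Re (z^T \<xi> z) with z = p - iq.\<close>

definition real_block :: "complex ^ 'n ^ 'n \<Rightarrow> real ^ ('n + 'n) ^ ('n + 'n)" where
  "real_block \<xi> = block_matrix (map_matrix Re \<xi>) (map_matrix Im \<xi>) (map_matrix Im \<xi>) (- map_matrix Re \<xi>)"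

text \<open>The matrix \<open>W\<close> passes from (p, q) to (z, conj z). In these coordinates z ->
  z + \<alpha> \<xi> H conj z and its conjugate form the block matrix \<open>Z\<close> with identity
  diagonal blocks, whose Schur complement is 1 - PQ = 1 - \<alpha>^2 M.\<close>

lemma det_real_block:
  fixes \<xi> :: "complex ^ 'n ^ 'n" and H :: "real ^ 'n ^ 'n"
  shows "complex_of_real (det (mat 1 + \<alpha> *\<^sub>R real_block \<xi> ** diag_block H)) =
    det (mat 1 - \<alpha>\<^sup>2 *\<^sub>R (\<xi> ** cmat H ** map_matrix cnj \<xi> ** cmat H))"
proof -
  let ?A = "map_matrix Re \<xi> ** H" and ?B = "map_matrix Im \<xi> ** H"
  define X where "X = mat 1 + \<alpha> *\<^sub>R real_block \<xi> ** diag_block H"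
  define W where "W = block_matrix (mat 1) (mat \<i>) (mat 1) (mat (- \<i>) :: complex ^ 'n ^ 'n)"
  define P Q where "P = \<alpha> *\<^sub>R \<xi> ** cmat H" and "Q = \<alpha> *\<^sub>R map_matrix cnj \<xi> ** cmat H"
  define Z where "Z = block_matrix (mat 1) P Q (mat 1)"
  have X: "X = block_matrix (mat 1 + \<alpha> *\<^sub>R ?A) (\<alpha> *\<^sub>R ?B) (\<alpha> *\<^sub>R ?B) (mat 1 - \<alpha> *\<^sub>R ?A)"
    unfolding X_def real_block_def diag_block_def scalar_matrix_assoc[symmetric] block_matrix_mult
    by (simp add: block_matrix_eq_iff mat_def) (simp add: matrix_matrix_mult_def sum_negf)
  have cX: "cmat X = block_matrix (mat 1 + cmat (\<alpha> *\<^sub>R ?A)) (cmat (\<alpha> *\<^sub>R ?B)) (cmat (\<alpha> *\<^sub>R ?B)) (mat 1 - cmat (\<alpha> *\<^sub>R ?A))"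
    by (simp add: X block_matrix_eq_iff mat_def)
  have P: "P = cmat (\<alpha> *\<^sub>R ?A) + mat \<i> ** cmat (\<alpha> *\<^sub>R ?B)"
    unfolding P_def scalar_matrix_assoc[symmetric] mat_mult
    by (simp add: vec_eq_iff matrix_matrix_mult_def complex_eq_iff)
  have Q: "Q = cmat (\<alpha> *\<^sub>R ?A) - mat \<i> ** cmat (\<alpha> *\<^sub>R ?B)"
    unfolding Q_def scalar_matrix_assoc[symmetric] mat_mult
    by (simp add: vec_eq_iff matrix_matrix_mult_def complex_eq_iff sum_negf)
  have "W ** cmat X = Z ** W"
    unfolding W_def Z_def cX block_matrix_mult P Q mat_mult mult_mat
    by (simp add: block_matrix_eq_iff) (simp add: mat_def algebra_simps)
  moreover have "det W \<noteq> 0"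
  proof -
    have "W ** block_matrix (mat 1) (mat 1) (mat (- \<i>)) (mat \<i>) = mat 2"
      unfolding W_def block_matrix_mult mat_mult mat_block_matrix[of 2]
      by (simp add: block_matrix_eq_iff) (simp add: mat_def)
    then have "det W * det (block_matrix (mat 1) (mat 1) (mat (- \<i>)) (mat \<i>) :: complex ^ ('n + 'n) ^ ('n + 'n)) = det (mat 2 :: complex ^ ('n + 'n) ^ ('n + 'n))"
      by (metis det_mul)
    then show ?thesis by (auto simp: det_mat)
  qed
  ultimately have "det (cmat X) = det Z"
    by (metis det_mul mult.commute mult_cancel_left)
  moreover have "P ** Q = \<alpha>\<^sup>2 *\<^sub>R (\<xi> ** cmat H ** map_matrix cnj \<xi> ** cmat H)"
    by (simp add: P_def Q_def scalar_matrix_assoc[symmetric] matrix_scalar_ac matrix_mul_assoc power2_eq_square)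
  ultimately show ?thesis
    by (simp add: det_cmat Z_def det_block_schur X_def)
qed

definition vec_join :: "'a ^ 'n \<Rightarrow> 'a ^ 'n \<Rightarrow> 'a ^ ('n + 'n)" where
  "vec_join p q = (\<chi> i. case i of Inl a \<Rightarrow> p $ a | Inr a \<Rightarrow> q $ a)"

lemma vec_join_eq_0: "vec_join p q = 0 \<longleftrightarrow> p = 0 \<and> q = 0"
  by (auto simp: vec_join_def vec_eq_iff all_sum_type)

lemma vec_join_cases:
  obtains p q where "x = vec_join p q"
proof
  show "x = vec_join (\<chi> a. x $ Inl a) (\<chi> a. x $ Inr a)"
    by (simp add: vec_eq_iff vec_join_def split: sum.split)
qed

lemma inner_block_matrix:
  fixes p q :: "real ^ 'n"
  shows "vec_join p q \<bullet> (block_matrix A B C D *v vec_join p q) =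
    p \<bullet> (A *v p) + p \<bullet> (B *v q) + q \<bullet> (C *v p) + q \<bullet> (D *v q)"
  by (simp add: inner_vec_def vec_join_def matrix_vector_mult_def sum_UNIV_sum sum.distrib distrib_left)

lemma herm_form_real:
  fixes p q :: "real ^ 'n"
  shows "herm_form H (\<chi> i. Complex (p $ i) (- q $ i)) = p \<bullet> (H *v p) + q \<bullet> (H *v q)"
  by (simp add: herm_form_def matrix_vector_mult_def inner_vec_def sum.distrib sum_negf sum_subtractf)

text \<open>After congruence by the doubled H this is the two-sided bound on V by its inverse. Under
  x = (p, q) and z = p - iq, the two forms become Re (z^T H \<xi> H z) and the Hermitian form of H
  at z, so \<open>norm_bilinear_le_trace\<close> with both arguments equal to z applies.\<close>

lemma real_block_form_less:
  fixes \<xi> :: "complex ^ 'n ^ 'n"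
  assumes H: "pos_definite H" and sym: "transpose \<xi> = \<xi>"
    and tr: "Re (trace (\<xi> ** cmat H ** map_matrix cnj \<xi> ** cmat H)) < 1"
    and x: "x \<noteq> 0"
  shows "\<bar>x \<bullet> ((diag_block H ** real_block \<xi> ** diag_block H) *v x)\<bar> < x \<bullet> (diag_block H *v x)"
proof -
  obtain p q where pq: "x = vec_join p q" by (rule vec_join_cases)
  define z where "z = (\<chi> i. Complex (p $ i) (- q $ i))"
  have z: "z \<noteq> 0"
    using x by (auto simp: z_def pq vec_join_eq_0) (auto simp: vec_eq_iff complex_eq_iff)
  have D: "x \<bullet> (diag_block H *v x) = herm_form H z"
    unfolding pq diag_block_def inner_block_matrix z_def herm_form_real by simp
  define N where "N = cmat H ** \<xi> ** cmat H"
  have "diag_block H ** real_block \<xi> ** diag_block H =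
      block_matrix (map_matrix Re N) (map_matrix Im N) (map_matrix Im N) (- map_matrix Re N)"
    unfolding diag_block_def real_block_def block_matrix_mult
    by (simp add: block_matrix_eq_iff) (simp add: N_def matrix_matrix_mult_def sum_negf)
  then have "x \<bullet> ((diag_block H ** real_block \<xi> ** diag_block H) *v x) = Re (\<Sum>i\<in>UNIV. z $ i * (N *v z) $ i)"
    unfolding pq by (simp only: inner_block_matrix)
      (simp add: inner_vec_def matrix_vector_mult_def z_def sum.distrib sum_subtractf sum_negf algebra_simps)
  moreover have "(norm (\<Sum>i\<in>UNIV. z $ i * (N *v z) $ i))\<^sup>2 < (herm_form H z)\<^sup>2"
  proof -
    have "(norm (\<Sum>i\<in>UNIV. z $ i * (N *v z) $ i))\<^sup>2 \<le> herm_form H z * herm_form H z *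
        Re (trace (\<xi> ** cmat H ** map_matrix cnj \<xi> ** cmat H))"
      unfolding N_def by (rule norm_bilinear_le_trace[OF pos_definite_imp_semidefinite[OF H] sym])
    also have "\<dots> < herm_form H z * herm_form H z * 1"
      using herm_form_pos[OF H z] by (intro mult_strict_left_mono[OF tr]) simp
    finally show ?thesis by (simp add: power2_eq_square)
  qed
  then have "norm (\<Sum>i\<in>UNIV. z $ i * (N *v z) $ i) < herm_form H z"
    using herm_form_pos[OF H z] by (simp add: power2_less_imp_less)
  ultimately show ?thesis
    unfolding D using abs_Re_le_cmod order_le_less_trans by metis
qed

lemma pos_definite_diag_block:
  assumes "pos_definite H"
  shows "pos_definite (diag_block H)"
  unfolding pos_definite_def
proof (intro conjI allI impI)
  show "transpose (diag_block H) = diag_block H"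
    using assms by (simp add: diag_block_def transpose_block_matrix pos_definite_def)
       (simp add: transpose_def vec_eq_iff zero_vec_def)
  fix x :: "real ^ ('a + 'a)"
  assume x: "x \<noteq> 0"
  obtain p q where pq: "x = vec_join p q" by (rule vec_join_cases)
  have "p \<noteq> 0 \<or> q \<noteq> 0" using x by (auto simp: pq vec_join_eq_0)
  then have "p \<bullet> (H *v p) + q \<bullet> (H *v q) > 0"
    using assms unfolding pos_definite_def
    by (metis add_pos_pos add.right_neutral add.left_neutral inner_zero_left)
  then show "x \<bullet> (diag_block H *v x) > 0"
    by (simp add: pq diag_block_def inner_block_matrix)
qed

subsection \<open>Derivatives of determinants and inverses\<close>

lemma matrix_diff_ldistrib:
  fixes A :: "'a::ring_1 ^ 'm ^ 'n"
  shows "A ** (B - C) = A ** B - A ** C"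
  by (simp add: vec_eq_iff matrix_matrix_mult_def right_diff_distrib sum_subtractf)

lemma matrix_diff_rdistrib:
  fixes A :: "'a::ring_1 ^ 'm ^ 'n"
  shows "(A - B) ** C = A ** C - B ** C"
  by (simp add: vec_eq_iff matrix_matrix_mult_def left_diff_distrib sum_subtractf)

text \<open>A permutation other than the identity moves at least two indices. After differentiating
  one factor, an off-diagonal entry of the identity is still left in the product, so only the
  diagonal term survives at t = 0.\<close>

lemma det_derivative_at_one:
  fixes N :: "real ^ 'm ^ 'm"
  shows "((\<lambda>t. det (mat 1 + t *\<^sub>R N)) has_real_derivative trace N) (at 0)"
proof -
  have "((\<lambda>t. \<Sum>p | p permutes UNIV. of_int (sign p) * (\<Prod>i\<in>UNIV. (mat 1 + t *\<^sub>R N) $ i $ p i))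
      has_real_derivative (\<Sum>p | p permutes UNIV. of_int (sign p) *
        (\<Sum>i\<in>UNIV. N $ i $ p i * (\<Prod>j\<in>UNIV - {i}. (mat 1 + 0 *\<^sub>R N) $ j $ p j)))) (at 0)"
    by (intro DERIV_sum DERIV_cmult has_field_derivative_prod) (auto intro!: derivative_eq_intros)
  moreover have "(\<Sum>p | p permutes UNIV. of_int (sign p) *
        (\<Sum>i\<in>UNIV. N $ i $ p i * (\<Prod>j\<in>UNIV - {i}. (mat 1 + 0 *\<^sub>R N) $ j $ p j))) = trace N"
  proof -
    have "of_int (sign p) * (\<Sum>i\<in>UNIV. N $ i $ p i * (\<Prod>j\<in>UNIV - {i}. (mat 1 + 0 *\<^sub>R N) $ j $ p j)) =
        (if p = id then trace N else 0)" if "p permutes UNIV" for p :: "'m \<Rightarrow> 'm"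
    proof (cases "p = id")
      case True
      then show ?thesis by (simp add: trace_def mat_def)
    next
      case False
      have *: "(\<Prod>j\<in>UNIV - {i}. (mat 1 + 0 *\<^sub>R N) $ j $ p j) = 0" for i
      proof -
        obtain j where j: "j \<noteq> i" "p j \<noteq> j"
        proof (rule ccontr)
          assume "\<not> thesis"
          then have "\<And>j. j \<in> UNIV - {i} \<Longrightarrow> p j = j" using that by blast
          then have "p permutes {i}"
            using permutes_superset[OF \<open>p permutes UNIV\<close>, of "{i}"] by blast
          then show False using False permutes_sing by (metis)
        qed
        then show ?thesis by (intro prod_zero) (auto simp: mat_def intro!: bexI[of _ j])
      qed
      show ?thesis using False unfolding * by simp
    qed
    then have "(\<Sum>p | p permutes UNIV. of_int (sign p) *
        (\<Sum>i\<in>UNIV. N $ i $ p i * (\<Prod>j\<in>UNIV - {i}. (mat 1 + 0 *\<^sub>R N) $ j $ p j))) =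
        (\<Sum>p | p permutes (UNIV :: 'm set). if p = id then trace N else 0)"
      by (intro sum.cong) auto
    also have "\<dots> = trace N" by (simp add: permutes_id)
    finally show ?thesis .
  qed
  ultimately show ?thesis by (simp add: det_def)
qed

lemma matrix_inv_mult:
  fixes A :: "real ^ 'm ^ 'm"
  assumes "invertible A"
  shows "matrix_inv A ** A = mat 1" "A ** matrix_inv A = mat 1"
proof -
  have "\<exists>B. A ** B = mat 1 \<and> B ** A = mat 1" using assms by (simp add: invertible_def)
  then have "A ** matrix_inv A = mat 1 \<and> matrix_inv A ** A = mat 1"
    unfolding matrix_inv_def by (rule someI_ex)
  then show "matrix_inv A ** A = mat 1" "A ** matrix_inv A = mat 1" by auto
qed

text \<open>Factoring out the matrix at the base point t reduces the claim to the derivative at the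
  identity.\<close>

lemma ln_det_derivative:
  fixes X :: "real ^ 'm ^ 'm"
  assumes "det (X + t *\<^sub>R J) > 0"
  shows "((\<lambda>t. ln (det (X + t *\<^sub>R J))) has_real_derivative trace (matrix_inv (X + t *\<^sub>R J) ** J)) (at t)"
proof -
  define Y where "Y = X + t *\<^sub>R J"
  have Y: "matrix_inv Y ** Y = mat 1" "Y ** matrix_inv Y = mat 1"
    using assms by (auto intro!: matrix_inv_mult simp: invertible_det_nz Y_def)
  have eq: "det (X + r *\<^sub>R J) = det Y * det (mat 1 + (r - t) *\<^sub>R (matrix_inv Y ** J))" for r
  proof -
    have "X + r *\<^sub>R J = Y + (r - t) *\<^sub>R J" by (simp add: Y_def algebra_simps)
    also have "\<dots> = Y ** (mat 1 + (r - t) *\<^sub>R (matrix_inv Y ** J))"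
      by (simp add: matrix_add_ldistrib matrix_scalar_ac scalar_matrix_assoc[symmetric] matrix_mul_assoc Y)
    finally show ?thesis by (simp add: det_mul)
  qed
  have "((\<lambda>r. det (mat 1 + r *\<^sub>R (matrix_inv Y ** J))) has_real_derivative trace (matrix_inv Y ** J)) (at (t + - t))"
    using det_derivative_at_one[of "matrix_inv Y ** J"] by simp
  then have "((\<lambda>r. det (mat 1 + (r - t) *\<^sub>R (matrix_inv Y ** J))) has_real_derivative trace (matrix_inv Y ** J)) (at t)"
    by (subst (asm) DERIV_shift) simp
  then have "((\<lambda>r. det (X + r *\<^sub>R J)) has_real_derivative det Y * trace (matrix_inv Y ** J)) (at t)"
    unfolding eq by (rule DERIV_cmult)
  then have "((\<lambda>r. ln (det (X + r *\<^sub>R J))) has_real_derivative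
      1 / det (X + t *\<^sub>R J) * (det Y * trace (matrix_inv Y ** J))) (at t)"
    by (rule DERIV_chain2[where f = ln and g = "\<lambda>r. det (X + r *\<^sub>R J)", OF DERIV_ln_divide[OF assms]])
  then show ?thesis using assms by (simp add: Y_def)
qed

lemma continuous_on_det:
  fixes X :: "'a::topological_space \<Rightarrow> 'b::real_normed_field ^ 'm ^ 'm"
  assumes "\<And>i j. continuous_on S (\<lambda>t. X t $ i $ j)"
  shows "continuous_on S (\<lambda>t. det (X t))"
  unfolding det_def by (intro continuous_intros assms)

text \<open>Cramer's rule, stated so that continuity of the inverse follows from continuity of
  determinants.\<close>

lemma matrix_inv_nth:
  fixes A :: "real ^ 'm ^ 'm"
  assumes "det A \<noteq> 0"
  shows "matrix_inv A $ k $ l = det (\<chi> i j. if j = k then axis l 1 $ i else A $ i $ j) / det A"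
proof -
  have "A *v (matrix_inv A *v axis l 1) = axis l 1"
    using assms by (simp add: matrix_vector_mul_assoc matrix_inv_mult invertible_det_nz)
  then have "matrix_inv A *v axis l 1 = (\<chi> k. det (\<chi> i j. if j = k then axis l 1 $ i else A $ i $ j) / det A)"
    using cramer[OF assms] by blast
  then have "(matrix_inv A *v axis l 1) $ k = det (\<chi> i j. if j = k then axis l 1 $ i else A $ i $ j) / det A"
    by simp
  then show ?thesis by (simp add: matrix_vector_mult_basis column_def)
qed

text \<open>By the resolvent identity Y_r - Y_t = -(r-t) Y_r J Y_t, the difference quotient equals
  -Tr(Y_r J Y_t J) exactly. Only continuity of Y is then needed to pass to the limit.\<close>

lemma trace_inv_derivative:
  fixes X :: "real ^ 'm ^ 'm"
  assumes "t \<in> U" "open U" "\<And>t. t \<in> U \<Longrightarrow> det (X + t *\<^sub>R J) \<noteq> 0"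
  shows "((\<lambda>t. trace (matrix_inv (X + t *\<^sub>R J) ** J)) has_real_derivative
    - trace (matrix_inv (X + t *\<^sub>R J) ** J ** matrix_inv (X + t *\<^sub>R J) ** J)) (at t)"
proof -
  define Y where "Y = (\<lambda>t. matrix_inv (X + t *\<^sub>R J))"
  have inv: "Y r ** (X + r *\<^sub>R J) = mat 1" "(X + r *\<^sub>R J) ** Y r = mat 1" if "r \<in> U" for r
    using assms(3)[OF that] by (auto simp: Y_def matrix_inv_mult invertible_det_nz)
  have diff: "Y r - Y t = - (r - t) *\<^sub>R (Y r ** J ** Y t)" if "r \<in> U" for r
  proof -
    have "Y r ** (X + t *\<^sub>R J) ** Y t = Y r"
      using inv(2)[OF assms(1)] by (simp add: matrix_mul_assoc[symmetric])
    moreover have "X + t *\<^sub>R J = (X + r *\<^sub>R J) - (r - t) *\<^sub>R J" by (simp add: algebra_simps)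
    ultimately have "Y r = Y r ** ((X + r *\<^sub>R J) - (r - t) *\<^sub>R J) ** Y t" by simp
    also have "\<dots> = Y t - (r - t) *\<^sub>R (Y r ** J ** Y t)"
    proof -
      have "Y r ** ((X + r *\<^sub>R J) - (r - t) *\<^sub>R J) = mat 1 - (r - t) *\<^sub>R (Y r ** J)"
        unfolding matrix_diff_ldistrib inv(1)[OF that]
        by (simp add: matrix_scalar_ac scalar_matrix_assoc[symmetric])
      then show ?thesis
        by (simp add: matrix_diff_rdistrib scalar_matrix_assoc[symmetric])
    qed
    finally have "Y r = Y t - (r - t) *\<^sub>R (Y r ** J ** Y t)" .
    from arg_cong[OF this, of "\<lambda>A. A - Y t"] show ?thesis by (simp flip: scaleR_minus_left)
  qed
  have contY: "continuous_on U (\<lambda>r. Y r $ k $ l)" for k l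
  proof -
    have "continuous_on U (\<lambda>r. (\<chi> i j. if j = k then axis l 1 $ i else (X + r *\<^sub>R J) $ i $ j) $ i $ j)" for i j
      by (cases "j = k") (auto intro!: continuous_intros)
    moreover have "continuous_on U (\<lambda>r. (X + r *\<^sub>R J) $ i $ j)" for i j
      by (auto intro!: continuous_intros)
    ultimately have "continuous_on U (\<lambda>r. det (\<chi> i j. if j = k then axis l 1 $ i else (X + r *\<^sub>R J) $ i $ j) / det (X + r *\<^sub>R J))"
      using assms(3) by (intro continuous_on_divide continuous_on_det ballI)
    then show ?thesis
      by (rule continuous_on_eq) (simp add: Y_def matrix_inv_nth assms(3))
  qed
  have "continuous_on U (\<lambda>r. - trace (Y r ** J ** Y t ** J))"
    unfolding trace_def matrix_matrix_mult_def vec_lambda_beta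
    by (intro continuous_on_minus continuous_on_sum continuous_on_mult continuous_on_const contY)
  then have lim: "((\<lambda>r. - trace (Y r ** J ** Y t ** J)) \<longlongrightarrow> - trace (Y t ** J ** Y t ** J)) (at t)"
    using assms(1,2) by (simp add: continuous_on_eq_continuous_at isCont_def)
  have "((\<lambda>r. (trace (Y r ** J) - trace (Y t ** J)) / (r - t)) \<longlongrightarrow> - trace (Y t ** J ** Y t ** J)) (at t)"
  proof (rule Lim_transform_within_open[OF lim assms(2,1)])
    fix r assume r: "r \<in> U" "r \<noteq> t"
    have "trace (Y r ** J) - trace (Y t ** J) = trace ((Y r - Y t) ** J)"
      by (simp add: trace_sub matrix_diff_rdistrib)
    also have "\<dots> = - (r - t) * trace (Y r ** J ** Y t ** J)"
      unfolding diff[OF r(1)] by (simp add: scalar_matrix_assoc[symmetric] trace_def sum_distrib_left)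
    finally show "- trace (Y r ** J ** Y t ** J) = (trace (Y r ** J) - trace (Y t ** J)) / (r - t)"
      using r(2) by (simp add: field_simps)
  qed
  then show ?thesis by (simp add: has_field_derivative_iff Y_def)
qed

subsection \<open>Strict convexity of the logarithmic determinants\<close>

text \<open>Regarded as a symmetric bilinear form in A and B with parameter K. It serves twice: with
  K a direction of Hessians and A, B inverse matrices, and later with K the real or imaginary part
  of \<xi> and A, B Hessians.\<close>

definition trace_form :: "real ^ 'm ^ 'm \<Rightarrow> real ^ 'm ^ 'm \<Rightarrow> real ^ 'm ^ 'm \<Rightarrow> real" where
  "trace_form K A B = trace (A ** K ** B ** K)"

lemma trace_form_commute: "trace_form K A B = trace_form K B A"
  using trace_mul_sym[of "A ** K" "B ** K"] by (simp add: trace_form_def matrix_mul_assoc)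

lemma trace_scaleR: "trace (c *\<^sub>R A) = c * trace (A :: real ^ 'm ^ 'm)"
  by (simp add: trace_def sum_distrib_left)

lemma matrix_add_rdistrib: "(A + B) ** C = A ** C + B ** C"
  by (simp add: vec_eq_iff matrix_matrix_mult_def distrib_right sum.distrib)

lemma trace_form_comb:
  "trace_form K (a *\<^sub>R A + b *\<^sub>R B) C = a * trace_form K A C + b * trace_form K B C"
  by (simp add: trace_form_def matrix_add_rdistrib scalar_matrix_assoc[symmetric] trace_add trace_scaleR)

lemma trace_form_comb_right:
  "trace_form K C (a *\<^sub>R A + b *\<^sub>R B) = a * trace_form K C A + b * trace_form K C B"
  by (subst (1 2 3) trace_form_commute) (rule trace_form_comb)

lemma trace_form_square:
  "trace_form K (a *\<^sub>R A + b *\<^sub>R B) (a *\<^sub>R A + b *\<^sub>R B) =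
    a\<^sup>2 * trace_form K A A + 2 * a * b * trace_form K A B + b\<^sup>2 * trace_form K B B"
  using trace_form_commute[of K A B]
  by (simp add: trace_form_comb trace_form_comb_right power2_eq_square algebra_simps)

lemma inner_matrix_symmetric:
  fixes A :: "real ^ 'm ^ 'm"
  assumes "transpose A = A"
  shows "y \<bullet> (A *v x) = x \<bullet> (A *v y)"
  using assms by (metis dot_lmul_matrix inner_commute transpose_matrix_vector)

lemma transpose_matrix_inv:
  fixes A :: "real ^ 'm ^ 'm"
  assumes "invertible A" "transpose A = A"
  shows "transpose (matrix_inv A) = matrix_inv A"
proof -
  have "transpose (matrix_inv A) ** A = mat 1"
    using matrix_inv_mult(2)[OF assms(1)] assms(2) by (metis matrix_transpose_mul transpose_mat)
  then have "transpose (matrix_inv A) ** A ** matrix_inv A = matrix_inv A"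
    by simp
  then show ?thesis
    by (simp add: matrix_mul_assoc[symmetric] matrix_inv_mult(2)[OF assms(1)])
qed

text \<open>Completing the square shows that 2 (w . x) - w . Zw never exceeds x . Z^-1 x. The test
  vector w = H^-1 x / c satisfies w . Zw < c (w . Hw) = w . x, so the left side is more than w . x,
  which is the form of H^-1 / c at x.\<close>

lemma inverse_strictly_antitone:
  fixes H Z :: "real ^ 'm ^ 'm"
  assumes H: "pos_definite H" and Z: "pos_definite Z" and c: "c > 0"
    and less: "\<And>x. x \<noteq> 0 \<Longrightarrow> x \<bullet> (Z *v x) < c * (x \<bullet> (H *v x))"
  shows "pos_definite (matrix_inv Z - (1 / c) *\<^sub>R matrix_inv H)"
proof -
  note invH = pos_definite_invertible[OF H] and invZ = pos_definite_invertible[OF Z]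
  have sym: "transpose H = H" "transpose Z = Z" using H Z by (auto simp: pos_definite_def)
  have "transpose (matrix_inv Z - (1 / c) *\<^sub>R matrix_inv H) = matrix_inv Z - (1 / c) *\<^sub>R matrix_inv H"
    using transpose_matrix_inv[OF invH sym(1)] transpose_matrix_inv[OF invZ sym(2)]
    by (simp add: transpose_def vec_eq_iff)
  moreover have "0 < x \<bullet> ((matrix_inv Z - (1 / c) *\<^sub>R matrix_inv H) *v x)" if "x \<noteq> 0" for x
  proof -
    define y where "y = matrix_inv Z *v x"
    define w where "w = (1 / c) *\<^sub>R (matrix_inv H *v x)"
    have Zy: "Z *v y = x" by (simp add: y_def matrix_vector_mul_assoc matrix_inv_mult invZ)
    have "H *v (matrix_inv H *v x) = x" by (simp add: matrix_vector_mul_assoc matrix_inv_mult invH)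
    then have Hw: "c *\<^sub>R (H *v w) = x" using c by (simp add: w_def matrix_vector_mult_scaleR)
    have w0: "w \<noteq> 0" using Hw that by auto
    have "0 \<le> (y - w) \<bullet> (Z *v (y - w))"
      using pos_definite_imp_semidefinite[OF Z] by (simp add: pos_semidefinite_def)
    also have "\<dots> = y \<bullet> x - 2 * (w \<bullet> x) + w \<bullet> (Z *v w)"
      using inner_matrix_symmetric[OF sym(2), of y w]
      by (simp add: matrix_vector_mult_diff_distrib inner_diff_left inner_diff_right Zy)
    finally have "2 * (w \<bullet> x) - w \<bullet> (Z *v w) \<le> y \<bullet> x" by simp
    moreover have "w \<bullet> (Z *v w) < w \<bullet> x"
      using less[OF w0] by (simp flip: Hw)
    ultimately have "w \<bullet> x < y \<bullet> x" by simp
    then show ?thesis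
      by (simp add: matrix_vector_mult_diff_rdistrib inner_diff_right y_def w_def inner_commute
            scaleR_matrix_vector_assoc[symmetric])
  qed
  ultimately show ?thesis by (auto simp: pos_definite_def)
qed

lemma pos_definite_scaleR:
  fixes A :: "real ^ 'm ^ 'm"
  assumes "pos_definite A" "c > 0"
  shows "pos_definite (c *\<^sub>R A)"
  using assms by (auto simp: pos_definite_def transpose_def vec_eq_iff scaleR_matrix_vector_assoc[symmetric])

lemma strict_convex_segment:
  fixes f f' f'' :: "real \<Rightarrow> real"
  assumes f: "\<And>t. 0 \<le> t \<Longrightarrow> t \<le> 1 \<Longrightarrow> (f has_real_derivative f' t) (at t)"
    and f': "\<And>t. 0 \<le> t \<Longrightarrow> t \<le> 1 \<Longrightarrow> (f' has_real_derivative f'' t) (at t)"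
    and pos: "\<And>t. 0 \<le> t \<Longrightarrow> t \<le> 1 \<Longrightarrow> f'' t > 0"
    and t: "0 < t" "t < 1"
  shows "f t < (1 - t) * f 0 + t * f 1"
proof -
  obtain a where a: "0 < a" "a < t" "f t - f 0 = (t - 0) * f' a"
    using MVT2[of 0 t f f'] f t by force
  obtain b where b: "t < b" "b < 1" "f 1 - f t = (1 - t) * f' b"
    using MVT2[of t 1 f f'] f t by force
  have "f' a < f' b"
    using a b t by (intro DERIV_pos_imp_increasing[of a b f']) (auto intro!: f' pos exI)
  then have "t * (1 - t) * f' a < t * (1 - t) * f' b"
    using t by simp
  moreover have "t * (1 - t) * f' a = (1 - t) * (f t - f 0)" using a by (simp add: mult_ac)
  moreover have "t * (1 - t) * f' b = t * (f 1 - f t)" using b by (simp add: mult_ac)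
  ultimately show ?thesis by (simp add: algebra_simps)
qed

text \<open>The matrix 1 + \<alpha>VH is not symmetric; multiplying by H from the left makes it the
  symmetric matrix H + \<alpha>HVH, which the bound on HVH places strictly between (1-\<alpha>)H and
  (1+\<alpha>)H.\<close>

lemma congruence_pos_definite:
  fixes H V :: "real ^ 'm ^ 'm"
  assumes H: "pos_definite H" and V: "transpose V = V" and \<alpha>: "0 < \<alpha>" "\<alpha> < 1"
    and bound: "\<And>x. x \<noteq> 0 \<Longrightarrow> \<bar>x \<bullet> ((H ** V ** H) *v x)\<bar> < x \<bullet> (H *v x)"
  defines "Z \<equiv> H ** (mat 1 + \<alpha> *\<^sub>R V ** H)"
  shows "pos_definite Z"
    and "x \<noteq> 0 \<Longrightarrow> x \<bullet> (Z *v x) < (1 + \<alpha>) * (x \<bullet> (H *v x))"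
    and "x \<noteq> 0 \<Longrightarrow> x \<bullet> (H *v x) < (1 / (1 - \<alpha>)) * (x \<bullet> (Z *v x))"
proof -
  have Z: "Z = H + \<alpha> *\<^sub>R (H ** V ** H)"
    by (simp add: Z_def matrix_add_ldistrib matrix_scalar_ac scalar_matrix_assoc[symmetric] matrix_mul_assoc)
  have Zx: "x \<bullet> (Z *v x) = x \<bullet> (H *v x) + \<alpha> * (x \<bullet> ((H ** V ** H) *v x))" for x
    by (simp add: Z matrix_vector_mult_add_rdistrib scaleR_matrix_vector_assoc[symmetric] inner_add_right)
  have ab: "\<bar>\<alpha> * (x \<bullet> ((H ** V ** H) *v x))\<bar> < \<alpha> * (x \<bullet> (H *v x))" if "x \<noteq> 0" for x
    using bound[OF that] \<alpha> by (simp add: abs_mult)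
  show 1: "x \<bullet> (Z *v x) < (1 + \<alpha>) * (x \<bullet> (H *v x))" if "x \<noteq> 0" for x
    using ab[OF that] by (simp add: Zx distrib_right)
  have 2: "(1 - \<alpha>) * (x \<bullet> (H *v x)) < x \<bullet> (Z *v x)" if "x \<noteq> 0" for x
    using ab[OF that] by (simp add: Zx left_diff_distrib)
  show "x \<bullet> (H *v x) < (1 / (1 - \<alpha>)) * (x \<bullet> (Z *v x))" if "x \<noteq> 0" for x
    using 2[OF that] \<alpha> by (simp add: field_simps)
  have "transpose H = H" using H by (simp add: pos_definite_def)
  then have "transpose (H ** V ** H) = H ** V ** H"
    using V by (simp add: matrix_transpose_mul matrix_mul_assoc)
  then have "transpose Z = Z"
    using \<open>transpose H = H\<close> by (simp add: Z transpose_def vec_eq_iff)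
  moreover have "0 < x \<bullet> (Z *v x)" if "x \<noteq> 0" for x
  proof -
    have "0 < (1 - \<alpha>) * (x \<bullet> (H *v x))" using H that \<alpha> by (simp add: pos_definite_def)
    with 2[OF that] show ?thesis by linarith
  qed
  ultimately show "pos_definite Z" by (simp add: pos_definite_def)
qed

lemma log_det_second_variation_pos:
  fixes H V K :: "real ^ 'm ^ 'm"
  assumes H: "pos_definite H" and V: "transpose V = V" and \<alpha>: "0 < \<alpha>" "\<alpha> < 1"
    and bound: "\<And>x. x \<noteq> 0 \<Longrightarrow> \<bar>x \<bullet> ((H ** V ** H) *v x)\<bar> < x \<bullet> (H *v x)"
    and K: "transpose K = K" "K \<noteq> 0"
  defines "T \<equiv> matrix_inv (mat 1 + \<alpha> *\<^sub>R V ** H) ** (\<alpha> *\<^sub>R V)"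
  shows "det (mat 1 + \<alpha> *\<^sub>R V ** H) > 0"
    and "trace (T ** K ** T ** K) + \<alpha>\<^sup>2 / (1 - \<alpha>\<^sup>2) * trace (matrix_inv H ** K ** matrix_inv H ** K) > 0"
proof -
  define X where "X = mat 1 + \<alpha> *\<^sub>R V ** H"
  define Z where "Z = H ** X"
  note Z = congruence_pos_definite[OF H V \<alpha> bound, folded X_def, folded Z_def]
  have "det Z = det H * det X" by (simp add: Z_def det_mul)
  then show dX: "det (mat 1 + \<alpha> *\<^sub>R V ** H) > 0"
    using pos_definite_det_pos[OF Z(1)] pos_definite_det_pos[OF H] by (simp add: X_def zero_less_mult_iff)
  define P where "P = matrix_inv H"
  define Q where "Q = matrix_inv Z"
  have P: "P ** H = mat 1" "H ** P = mat 1" using H by (simp_all add: P_def matrix_inv_mult pos_definite_invertible)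
  have Q: "Q ** Z = mat 1" "Z ** Q = mat 1" using Z(1) by (simp_all add: Q_def matrix_inv_mult pos_definite_invertible)
  have invX: "invertible X" using dX by (simp add: X_def invertible_det_nz)
  have "(Q ** H) ** X = mat 1" using Q(1) unfolding Z_def matrix_mul_assoc .
  then have QH: "matrix_inv X = Q ** H"
    by (metis invX matrix_inv_mult(2) matrix_mul_assoc matrix_mul_lid matrix_mul_rid)
  \<comment> \<open>Since \<alpha>VH = X - 1 and X^-1 = QH, the product TH equals 1 - QH. Cancelling
    H gives T = P - Q, so comparing T with P amounts to comparing the inverses of Z and H.\<close>
  have aVH: "\<alpha> *\<^sub>R V ** H = X - mat 1" by (simp add: X_def)
  have "T ** H = mat 1 - Q ** H"
    unfolding T_def X_def[symmetric] matrix_mul_assoc[symmetric] aVH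
    by (simp add: matrix_diff_ldistrib matrix_inv_mult(1)[OF invX]) (simp add: QH)
  then have "T ** H ** P = (mat 1 - Q ** H) ** P" by simp
  then have T: "T = P - Q"
    by (simp add: matrix_mul_assoc[symmetric] P(2) matrix_diff_rdistrib)
  \<comment> \<open>Chosen so that 1/(1+\<alpha>) = 1 - \<beta> and 1/(1-\<alpha>) = 1 + \<gamma>.
    The two comparisons of Q with P then say exactly that \<beta>P - T and \<gamma>P + T are
    positive definite.\<close>
  define \<beta> \<gamma> where "\<beta> = \<alpha> / (1 + \<alpha>)" and "\<gamma> = \<alpha> / (1 - \<alpha>)"
  have bg: "\<beta> > 0" "\<gamma> > 0" "\<beta> * \<gamma> = \<alpha>\<^sup>2 / (1 - \<alpha>\<^sup>2)"
    using \<alpha> by (simp_all add: \<beta>_def \<gamma>_def power2_eq_square algebra_simps)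
  have "Q - (1 / (1 + \<alpha>)) *\<^sub>R P = \<beta> *\<^sub>R P + (-1) *\<^sub>R T"
  proof -
    have "1 / (1 + \<alpha>) = 1 - \<beta>" using \<alpha> by (simp add: \<beta>_def field_simps)
    then show ?thesis unfolding T by (simp only:) (simp add: algebra_simps)
  qed
  moreover have "pos_definite (Q - (1 / (1 + \<alpha>)) *\<^sub>R P)"
    unfolding P_def Q_def using \<alpha> by (intro inverse_strictly_antitone H Z) auto
  ultimately have A1: "trace_form K (\<beta> *\<^sub>R P + (-1) *\<^sub>R T) (\<beta> *\<^sub>R P + (-1) *\<^sub>R T) > 0"
    using trace_pd_pos[OF _ K] by (simp add: trace_form_def)
  \<comment> \<open>Here \<open>inverse_strictly_antitone\<close> is used with Z and H exchanged and
    c = 1/(1-\<alpha>), which explains the nested reciprocal.\<close>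
  have "(1 / (1 - \<alpha>)) *\<^sub>R (P - (1 / (1 / (1 - \<alpha>))) *\<^sub>R Q) = \<gamma> *\<^sub>R P + 1 *\<^sub>R T"
  proof -
    have "1 / (1 - \<alpha>) = 1 + \<gamma>" using \<alpha> by (simp add: \<gamma>_def field_simps)
    moreover have "(1 / (1 - \<alpha>)) *\<^sub>R (P - (1 / (1 / (1 - \<alpha>))) *\<^sub>R Q) = (1 / (1 - \<alpha>)) *\<^sub>R P - Q"
      using \<alpha> by (simp add: scaleR_diff_right)
    ultimately show ?thesis unfolding T by (simp only:) (simp add: algebra_simps)
  qed
  moreover have "pos_definite ((1 / (1 - \<alpha>)) *\<^sub>R (P - (1 / (1 / (1 - \<alpha>))) *\<^sub>R Q))"
    unfolding P_def Q_def using \<alpha> by (intro pos_definite_scaleR inverse_strictly_antitone H Z) auto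
  ultimately have A2: "trace_form K (\<gamma> *\<^sub>R P + 1 *\<^sub>R T) (\<gamma> *\<^sub>R P + 1 *\<^sub>R T) > 0"
    using trace_pd_pos[OF _ K] by (simp add: trace_form_def)
  \<comment> \<open>The weights \<gamma> and \<beta> make the mixed terms in T and P cancel, leaving
    a positive multiple of the quantity sought.\<close>
  have "\<gamma> * trace_form K (\<beta> *\<^sub>R P + (-1) *\<^sub>R T) (\<beta> *\<^sub>R P + (-1) *\<^sub>R T) +
      \<beta> * trace_form K (\<gamma> *\<^sub>R P + 1 *\<^sub>R T) (\<gamma> *\<^sub>R P + 1 *\<^sub>R T) =
      (\<beta> + \<gamma>) * (trace_form K T T + \<beta> * \<gamma> * trace_form K P P)"
    unfolding trace_form_square by (simp add: algebra_simps power2_eq_square)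
  moreover have "0 < \<gamma> * trace_form K (\<beta> *\<^sub>R P + (-1) *\<^sub>R T) (\<beta> *\<^sub>R P + (-1) *\<^sub>R T) +
      \<beta> * trace_form K (\<gamma> *\<^sub>R P + 1 *\<^sub>R T) (\<gamma> *\<^sub>R P + 1 *\<^sub>R T)"
    using A1 A2 bg by (intro add_pos_pos mult_pos_pos)
  ultimately have "0 < trace_form K T T + \<beta> * \<gamma> * trace_form K P P"
    using bg by (simp add: zero_less_mult_iff)
  then show "trace (T ** K ** T ** K) + \<alpha>\<^sup>2 / (1 - \<alpha>\<^sup>2) * trace (matrix_inv H ** K ** matrix_inv H ** K) > 0"
    by (simp add: trace_form_def bg P_def)
qed

lemma log_det_strictly_convex:
  fixes H K V :: "real ^ 'm ^ 'm"
  assumes H: "\<And>t. 0 \<le> t \<Longrightarrow> t \<le> 1 \<Longrightarrow> pos_definite (H + t *\<^sub>R K)"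
    and V: "transpose V = V" and \<alpha>: "0 < \<alpha>" "\<alpha> < 1"
    and bound: "\<And>t x. 0 \<le> t \<Longrightarrow> t \<le> 1 \<Longrightarrow> x \<noteq> 0 \<Longrightarrow>
      \<bar>x \<bullet> (((H + t *\<^sub>R K) ** V ** (H + t *\<^sub>R K)) *v x)\<bar> < x \<bullet> ((H + t *\<^sub>R K) *v x)"
    and K: "transpose K = K" "K \<noteq> 0"
    and t: "0 < t" "t < 1"
  defines "w \<equiv> \<lambda>t. - ln (det (mat 1 + \<alpha> *\<^sub>R V ** (H + t *\<^sub>R K))) - \<alpha>\<^sup>2 / (1 - \<alpha>\<^sup>2) * ln (det (H + t *\<^sub>R K))"
  shows "w t < (1 - t) * w 0 + t * w 1"
proof -
  define X where "X = mat 1 + \<alpha> *\<^sub>R V ** H"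
  define J where "J = \<alpha> *\<^sub>R V ** K"
  define c where "c = \<alpha>\<^sup>2 / (1 - \<alpha>\<^sup>2)"
  have X: "mat 1 + \<alpha> *\<^sub>R V ** (H + t *\<^sub>R K) = X + t *\<^sub>R J" for t
    by (simp add: X_def J_def matrix_add_ldistrib matrix_scalar_ac scalar_matrix_assoc[symmetric] add.assoc)
  define w' where "w' = (\<lambda>t. - trace (matrix_inv (X + t *\<^sub>R J) ** J) - c * trace (matrix_inv (H + t *\<^sub>R K) ** K))"
  define w'' where "w'' = (\<lambda>t. - (- trace (matrix_inv (X + t *\<^sub>R J) ** J ** matrix_inv (X + t *\<^sub>R J) ** J))
      - c * (- trace (matrix_inv (H + t *\<^sub>R K) ** K ** matrix_inv (H + t *\<^sub>R K) ** K)))"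
  note * = log_det_second_variation_pos[OF H V \<alpha> bound K, unfolded X]
  have detH: "det (H + t *\<^sub>R K) > 0" if "0 \<le> t" "t \<le> 1" for t
    using pos_definite_det_pos[OF H] that by blast
  have detX: "det (X + t *\<^sub>R J) > 0" if "0 \<le> t" "t \<le> 1" for t
    using *(1) that by blast
  have open_nz: "open {t. det (A + t *\<^sub>R B) \<noteq> 0}" for A B :: "real ^ 'm ^ 'm"
    by (intro open_Collect_neq continuous_on_det continuous_intros)
  have inv: "((\<lambda>t. trace (matrix_inv (A + t *\<^sub>R B) ** B)) has_real_derivative
      - trace (matrix_inv (A + t *\<^sub>R B) ** B ** matrix_inv (A + t *\<^sub>R B) ** B)) (at t)"
    if "det (A + t *\<^sub>R B) > 0" for A B :: "real ^ 'm ^ 'm" and t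
    using that by (intro trace_inv_derivative[OF _ open_nz]) auto
  show ?thesis
  proof (rule strict_convex_segment[where f' = w' and f'' = w''])
    fix t :: real
    assume t: "0 \<le> t" "t \<le> 1"
    show "(w has_real_derivative w' t) (at t)"
      unfolding w_def w'_def X c_def
      by (intro DERIV_diff DERIV_minus DERIV_cmult ln_det_derivative detX detH t)
    show "(w' has_real_derivative w'' t) (at t)"
      unfolding w'_def w''_def
      by (intro DERIV_diff DERIV_minus DERIV_cmult inv detX detH t)
    \<comment> \<open>Grouping \<alpha>V with the inverse instead of with K turns the second
      derivative into the trace of (TK)^2.\<close>
    have "matrix_inv (X + t *\<^sub>R J) ** J ** matrix_inv (X + t *\<^sub>R J) ** J =
        (matrix_inv (X + t *\<^sub>R J) ** (\<alpha> *\<^sub>R V)) ** K ** (matrix_inv (X + t *\<^sub>R J) ** (\<alpha> *\<^sub>R V)) ** K"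
      by (simp add: J_def matrix_mul_assoc)
    then show "w'' t > 0"
      using *(2)[OF t t] by (simp add: w''_def c_def)
  qed fact+
qed

subsection \<open>The integral representation of the spectral function\<close>

text \<open>The removable singularity at 0 is filled in because it is reached at \<theta> = pi/2 for
  every x, and for every \<theta> at x = 0.\<close>

definition log_quot :: "real \<Rightarrow> real" where
  "log_quot z = (if z = 0 then 1 else - ln (1 - z) / z)"

lemma continuous_on_log_quot: "continuous_on {..<1} log_quot"
proof (intro continuous_at_imp_continuous_on ballI)
  fix z :: real assume z: "z \<in> {..<1}"
  show "isCont log_quot z"
  proof (cases "z = 0")
    case True
    have "((\<lambda>z. - ln (1 - z)) has_field_derivative 1) (at (0::real))"
      by (auto intro!: derivative_eq_intros)
    then have "((\<lambda>z. - ln (1 - z) / z) \<longlongrightarrow> 1) (at (0::real))"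
      by (simp add: DERIV_def)
    then have "(log_quot \<longlongrightarrow> 1) (at 0)"
      by (rule Lim_transform_eventually) (auto simp: log_quot_def eventually_at intro!: exI[of _ 1])
    then show ?thesis by (simp add: True isCont_def log_quot_def)
  next
    case False
    have "isCont (\<lambda>z. - ln (1 - z) / z) z"
      using False z by (intro continuous_intros) auto
    moreover have "eventually (\<lambda>w. - ln (1 - w) / w = log_quot w) (nhds z)"
      using False t1_space_nhds[of z 0]
      by (auto simp: log_quot_def elim!: eventually_mono)
    ultimately show ?thesis by (subst (asm) isCont_cong) auto
  qed
qed

text \<open>This is -tan^2 \<theta> log(1 - x cos^2 \<theta>) without the pole of tan, and so
  continuous on the closed interval of integration.\<close>

definition hk_kernel :: "real \<Rightarrow> real \<Rightarrow> real" where
  "hk_kernel x \<theta> = x * (sin \<theta>)\<^sup>2 * log_quot (x * (cos \<theta>)\<^sup>2)"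

lemma hk_kernel_eq:
  "cos \<theta> \<noteq> 0 \<Longrightarrow> hk_kernel x \<theta> = - ((tan \<theta>)\<^sup>2 * ln (1 - x * (cos \<theta>)\<^sup>2))"
  by (simp add: hk_kernel_def log_quot_def tan_def field_simps)

lemma mult_cos_square_less_one:
  fixes x :: real
  assumes "x < 1"
  shows "x * (cos \<theta>)\<^sup>2 < 1"
proof (cases "x \<le> 0")
  case True
  then have "x * (cos \<theta>)\<^sup>2 \<le> 0" by (simp add: mult_nonpos_nonneg)
  then show ?thesis by simp
next
  case False
  then have "x * (cos \<theta>)\<^sup>2 \<le> x" by (simp add: cos_squared_eq mult_left_le)
  with assms show ?thesis by simp
qed

lemma continuous_on_hk_kernel: "x < 1 \<Longrightarrow> continuous_on S (hk_kernel x)"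
  unfolding hk_kernel_def
  by (intro continuous_intros continuous_on_compose2[OF continuous_on_log_quot])
     (auto intro: mult_cos_square_less_one)

lemma hk_kernel_derivative:
  assumes "x < 1"
  shows "((\<lambda>x. hk_kernel x \<theta>) has_field_derivative (sin \<theta>)\<^sup>2 / (1 - x * (cos \<theta>)\<^sup>2)) (at x within U)"
proof (cases "cos \<theta> = 0")
  case True
  then have "(sin \<theta>)\<^sup>2 = 1" by (simp add: sin_squared_eq)
  with True show ?thesis
    by (auto simp: hk_kernel_def log_quot_def intro!: derivative_eq_intros)
next
  case False
  have "((\<lambda>x. - ((tan \<theta>)\<^sup>2 * ln (1 - x * (cos \<theta>)\<^sup>2))) has_field_derivative
      (tan \<theta>)\<^sup>2 * (cos \<theta>)\<^sup>2 / (1 - x * (cos \<theta>)\<^sup>2)) (at x within U)"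
    using mult_cos_square_less_one[OF assms, of \<theta>]
    by (auto intro!: derivative_eq_intros simp: field_simps)
  with False show ?thesis
    by (simp add: hk_kernel_eq tan_def power_divide)
qed

text \<open>The algebra behind the antiderivative used below, with S and C in place of sine and
  cosine and s = sqrt(1-x).\<close>

lemma arctan_derivative_identity:
  fixes s S C :: real
  assumes "0 < s" "s < 1" "S\<^sup>2 + C\<^sup>2 = 1" "x = 1 - s\<^sup>2"
  defines "D \<equiv> s * C\<^sup>2 + S\<^sup>2"
  shows "D > 0"
    and "(1 - s * (1 + ((1 - s) * ((C * C - S * S) * D - (S * C) * (2 * S * C - s * (2 * S * C))) / D\<^sup>2) /
           (1 + ((1 - s) * (S * C) / D)\<^sup>2))) / x = S\<^sup>2 / (1 - x * C\<^sup>2)"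
proof -
  show D: "D > 0"
  proof (cases "C = 0")
    case False
    then show ?thesis using assms by (simp add: add_pos_nonneg)
  qed (use assms in auto)
  have C2: "C\<^sup>2 = 1 - S\<^sup>2" using assms by simp
  define E where "E = s\<^sup>2 * C\<^sup>2 + S\<^sup>2"
  have E: "E = 1 - x * C\<^sup>2" unfolding assms(4) E_def C2 by (simp add: algebra_simps)
  \<comment> \<open>The two-square identity for (sC, S) and (C, S).\<close>
  have "D\<^sup>2 + ((1 - s) * (S * C))\<^sup>2 = E"
  proof -
    have "D\<^sup>2 + ((1 - s) * (S * C))\<^sup>2 = (s\<^sup>2 * C\<^sup>2 + S\<^sup>2) * (S\<^sup>2 + C\<^sup>2)"
      unfolding D_def by algebra
    then show ?thesis by (simp add: assms(3) E_def)
  qed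
  then have q: "1 + ((1 - s) * (S * C) / D)\<^sup>2 = E / D\<^sup>2"
    using D by (simp add: power_divide field_simps)
  have E0: "E > 0"
    unfolding q[symmetric] using D q
    by (smt (verit, best) zero_less_divide_iff zero_less_power zero_le_power2)
  have "(C * C - S * S) * D - (S * C) * (2 * S * C - s * (2 * S * C)) = (s * C\<^sup>2 - S\<^sup>2) * (S\<^sup>2 + C\<^sup>2)"
    unfolding D_def by algebra
  then have n: "(C * C - S * S) * D - (S * C) * (2 * S * C - s * (2 * S * C)) = s * C\<^sup>2 - S\<^sup>2"
    by (simp add: assms(3))
  have x0: "x > 0" using assms by (simp add: power_less_one_iff)
  have "E - s * (E + (1 - s) * (s * C\<^sup>2 - S\<^sup>2)) = x * S\<^sup>2"
    unfolding E_def C2 assms(4) by algebra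
  then show "(1 - s * (1 + ((1 - s) * ((C * C - S * S) * D - (S * C) * (2 * S * C - s * (2 * S * C))) / D\<^sup>2) /
           (1 + ((1 - s) * (S * C) / D)\<^sup>2))) / x = S\<^sup>2 / (1 - x * C\<^sup>2)"
  proof -
    assume id: "E - s * (E + (1 - s) * (s * C\<^sup>2 - S\<^sup>2)) = x * S\<^sup>2"
    have "(1 - s) * (s * C\<^sup>2 - S\<^sup>2) / D\<^sup>2 / (E / D\<^sup>2) = (1 - s) * (s * C\<^sup>2 - S\<^sup>2) / E"
      using D by simp
    moreover have "1 - s * (1 + y / E) = (E - s * (E + y)) / E" for y
      using E0 by (simp add: field_simps)
    ultimately show ?thesis
      unfolding q n E[symmetric] using x0 id D E0 by simp
  qed
qed

lemma has_integral_hk_kernel_derivative: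
  assumes x: "0 < x" "x < 1"
  shows "((\<lambda>\<theta>. (sin \<theta>)\<^sup>2 / (1 - x * (cos \<theta>)\<^sup>2)) has_integral pi / 2 / (1 + sqrt (1 - x))) {0..pi/2}"
proof -
  define s where "s = sqrt (1 - x)"
  have s: "0 < s" "s < 1" "x = 1 - s\<^sup>2" using x by (auto simp: s_def)
  \<comment> \<open>The usual primitive of 1/(1 - x cos^2) is arctan(tan \<theta> / s)/s, which is
    undefined at pi/2. By the addition formula arctan(tan \<theta> / s) = \<theta> + arctan(q
    \<theta>) before that point, and the right side extends smoothly. The primitive \<open>A\<close>
    then comes from x sin^2 = (1 - x cos^2) - s^2.\<close>
  define q where "q = (\<lambda>\<theta>. (1 - s) * (sin \<theta> * cos \<theta>) / (s * (cos \<theta>)\<^sup>2 + (sin \<theta>)\<^sup>2))"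
  define A where "A = (\<lambda>\<theta>. (\<theta> - s * (\<theta> + arctan (q \<theta>))) / x)"
  have "(A has_real_derivative (sin \<theta>)\<^sup>2 / (1 - x * (cos \<theta>)\<^sup>2)) (at \<theta> within {0..pi/2})" for \<theta>
  proof -
    define D where "D = s * (cos \<theta>)\<^sup>2 + (sin \<theta>)\<^sup>2"
    have sc: "(sin \<theta>)\<^sup>2 + (cos \<theta>)\<^sup>2 = 1" by simp
    note id = arctan_derivative_identity[OF s(1,2) sc s(3), folded D_def]
    define N where "N = (1 - s) * ((cos \<theta> * cos \<theta> - sin \<theta> * sin \<theta>) * D - (sin \<theta> * cos \<theta>) * (2 * sin \<theta> * cos \<theta> - s * (2 * sin \<theta> * cos \<theta>))) / D\<^sup>2"
    have "(q has_real_derivative (1 - s) * ((cos \<theta> * cos \<theta> - sin \<theta> * sin \<theta>) * D - (sin \<theta> * cos \<theta>) * (2 * sin \<theta> * cos \<theta> - s * (2 * sin \<theta> * cos \<theta>))) / D\<^sup>2) (at \<theta> within {0..pi/2})"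
      unfolding q_def using id(1)
      by (auto intro!: derivative_eq_intros simp: D_def power2_eq_square algebra_simps)
    then have "(A has_real_derivative (1 - s * (1 + inverse (1 + (q \<theta>)\<^sup>2) * N)) / x) (at \<theta> within {0..pi/2})"
      unfolding A_def N_def
      by (intro DERIV_cdivide DERIV_diff DERIV_ident DERIV_cmult DERIV_add DERIV_chain2[OF DERIV_arctan])
    moreover have "inverse (1 + (q \<theta>)\<^sup>2) * N = N / (1 + ((1 - s) * (sin \<theta> * cos \<theta>) / D)\<^sup>2)"
      by (simp only: q_def D_def divide_inverse mult.commute)
    ultimately show ?thesis using id(2)[folded N_def] by simp
  qed
  then have "((\<lambda>\<theta>. (sin \<theta>)\<^sup>2 / (1 - x * (cos \<theta>)\<^sup>2)) has_integral A (pi/2) - A 0) {0..pi/2}"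
    by (intro fundamental_theorem_of_calculus) (auto simp: has_real_derivative_iff_has_vector_derivative)
  \<comment> \<open>The function q vanishes at both endpoints, so the arctangent contributes
    nothing.\<close>
  moreover have "A (pi/2) - A 0 = pi / 2 / (1 + s)"
  proof -
    have "x = (1 - s) * (1 + s)" using s by (simp add: power2_eq_square algebra_simps)
    moreover have "A (pi/2) - A 0 = (pi/2) * (1 - s) / x" using x by (simp add: A_def q_def field_simps)
    ultimately show ?thesis using s by simp
  qed
  ultimately show ?thesis by (simp add: s_def)
qed

lemma hk_fun_derivative:
  assumes "x < 1"
  shows "(hk_fun has_real_derivative 1 / (2 * (1 + sqrt (1 - x)))) (at x)"
proof -
  have s: "sqrt (1 - x) > 0" using assms by simp
  have r: "((\<lambda>x. sqrt (1 - x)) has_real_derivative - (1 / (2 * sqrt (1 - x)))) (at x)"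
  proof (rule DERIV_cong[OF DERIV_chain2[OF DERIV_real_sqrt DERIV_diff[OF DERIV_const DERIV_ident]]])
    show "0 < 1 - x" using assms by simp
    show "inverse (sqrt (1 - x)) / 2 * (0 - 1) = - (1 / (2 * sqrt (1 - x)))" by (simp add: field_simps)
  qed
  have l: "((\<lambda>x. ln (1 + sqrt (1 - x))) has_real_derivative
      1 / (1 + sqrt (1 - x)) * (0 + - (1 / (2 * sqrt (1 - x))))) (at x)"
    by (rule DERIV_chain2[where f = ln and g = "\<lambda>x. 1 + sqrt (1 - x)", OF DERIV_ln_divide DERIV_add[OF DERIV_const r]])
       (rule add_pos_pos[OF zero_less_one s])
  have "((\<lambda>x. 1 - sqrt (1 - x) + ln (1 + sqrt (1 - x))) has_real_derivative
      (0 - - (1 / (2 * sqrt (1 - x))) + 1 / (1 + sqrt (1 - x)) * (0 + - (1 / (2 * sqrt (1 - x)))))) (at x)"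
    by (rule DERIV_add[OF DERIV_diff[OF DERIV_const r] l])
  then have "(hk_fun has_real_derivative (1 / (2 * sqrt (1 - x)) - 1 / (2 * sqrt (1 - x)) / (1 + sqrt (1 - x)))) (at x)"
    unfolding hk_fun_def[abs_def] by (simp add: mult.commute)
  moreover have "1 / (2 * r) - 1 / (2 * r) / (1 + r) = 1 / (2 * (1 + r))" if "r > 0" for r :: real
  proof -
    have "r * 2 + r * (r * 2) > 0" using that by (intro add_pos_pos mult_pos_pos) auto
    then show ?thesis using that by (simp add: field_simps)
  qed
  ultimately show ?thesis using s by simp
qed

text \<open>Both sides have the same derivative in x, by differentiation under the integral sign,
  and agree at x = 0 because f(0) = log 2.\<close>

lemma hk_kernel_integral:
  assumes x: "0 \<le> x" "x < 1"
  shows "integral {0..pi/2} (hk_kernel x) = pi * (hk_fun x - ln 2)"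
proof -
  define F where "F = (\<lambda>x. integral {0..pi/2} (hk_kernel x))"
  have leib: "(F has_field_derivative integral {0..pi/2} (\<lambda>\<theta>. (sin \<theta>)\<^sup>2 / (1 - x * (cos \<theta>)\<^sup>2))) (at x)"
    if "x < 1" for x
  proof -
    have "(F has_field_derivative integral (cbox 0 (pi/2)) (\<lambda>\<theta>. (sin \<theta>)\<^sup>2 / (1 - x * (cos \<theta>)\<^sup>2))) (at x within {..<1})"
      unfolding F_def cbox_interval[symmetric]
    proof (rule leibniz_rule_field_derivative)
      show "continuous_on ({..<1} \<times> cbox 0 (pi / 2)) (\<lambda>(x, \<theta>). (sin \<theta>)\<^sup>2 / (1 - x * (cos \<theta>)\<^sup>2))"
      proof -
        have "1 - fst p * (cos (snd p))\<^sup>2 \<noteq> 0" if "p \<in> {..<1} \<times> cbox 0 (pi / 2)" for p :: "real \<times> real"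
          using mult_cos_square_less_one[of "fst p" "snd p"] that by auto
        then show ?thesis
          unfolding split_beta by (intro continuous_intros) blast
      qed
    qed (use that in \<open>auto intro!: hk_kernel_derivative integrable_continuous_interval continuous_on_hk_kernel\<close>)
    with that show ?thesis by (simp add: at_within_open[of x "{..<1}"])
  qed
  \<comment> \<open>The closed form of the derivative was obtained for x > 0 only, its primitive
    having a factor 1/x. Continuity of d on the closed interval covers the endpoint 0.\<close>
  define d where "d = (\<lambda>x. F x - pi * hk_fun x)"
  have der: "(d has_real_derivative 0) (at x)" if "0 < x" "x < 1" for x
  proof -
    have "(F has_real_derivative pi / 2 / (1 + sqrt (1 - x))) (at x)"
      using leib[OF that(2)] has_integral_hk_kernel_derivative[OF that] by (simp add: integral_unique)
    then have "(d has_real_derivative pi / 2 / (1 + sqrt (1 - x)) - pi * (1 / (2 * (1 + sqrt (1 - x))))) (at x)"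
      unfolding d_def by (intro DERIV_diff DERIV_cmult hk_fun_derivative that)
    then show ?thesis by simp
  qed
  have "isCont d z" if "z < 1" for z
    unfolding d_def using leib[OF that] hk_fun_derivative[OF that] by (intro continuous_intros DERIV_isCont)
  then have "continuous_on {0..x} d"
    using x by (intro continuous_at_imp_continuous_on) auto
  then have "d x = d 0"
    using x der DERIV_isconst_end[of 0 x d] by (cases "x = 0") auto
  moreover have "hk_kernel 0 = (\<lambda>_. 0)" by (simp add: hk_kernel_def fun_eq_iff)
  then have "d 0 = - pi * ln 2" by (simp add: d_def F_def hk_fun_def)
  ultimately show ?thesis by (simp add: d_def F_def algebra_simps)
qed

subsection \<open>Strict convexity of the energy density\<close>

definition higgs_matrix :: "complex ^ 'n ^ 'n \<Rightarrow> real ^ 'n ^ 'n \<Rightarrow> complex ^ 'n ^ 'n" where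
  "higgs_matrix \<xi> H = \<xi> ** cmat H ** map_matrix cnj \<xi> ** cmat H"

lemma hk_matrix_eq: "hk_matrix u \<xi> y = higgs_matrix (\<xi> y) (hessian u y)"
  by (simp add: hk_matrix_def higgs_matrix_def)

definition admissible_form :: "complex ^ 'n ^ 'n \<Rightarrow> real ^ 'n ^ 'n \<Rightarrow> bool" where
  "admissible_form \<xi> H \<longleftrightarrow> pos_definite H \<and> Re (trace (higgs_matrix \<xi> H)) < 1"

text \<open>Defined through the determinant and not the eigenvalues, so that its dependence on \<xi>
  and H is visibly regular. The determinant is real for admissible H by
  \<open>det_higgs_matrix\<close>, so \<open>Re\<close> is a coercion there.\<close>

definition det_kernel :: "complex ^ 'n ^ 'n \<Rightarrow> real ^ 'n ^ 'n \<Rightarrow> real \<Rightarrow> real" where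
  "det_kernel \<xi> H \<theta> = - ((tan \<theta>)\<^sup>2 * ln (Re (det (mat 1 - (cos \<theta>)\<^sup>2 *\<^sub>R higgs_matrix \<xi> H))))"

text \<open>Open at both ends, so that 0 < cos \<theta> < 1 as strict convexity requires.\<close>

abbreviation quarter :: "real set" where "quarter \<equiv> {0<..<pi/2}"

lemma set_integral_hk_kernel:
  assumes "0 \<le> x" "x < 1"
  shows "set_integrable lborel quarter (hk_kernel x)"
    and "(LINT \<theta>:quarter|lborel. hk_kernel x \<theta>) = pi * (hk_fun x - ln 2)"
proof -
  have "set_integrable lborel {0..pi/2} (hk_kernel x)"
    using assms by (intro borel_integrable_atLeastAtMost' continuous_on_hk_kernel)
  then show *: "set_integrable lborel quarter (hk_kernel x)"
    by (rule set_integrable_subset) auto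
  show "(LINT \<theta>:quarter|lborel. hk_kernel x \<theta>) = pi * (hk_fun x - ln 2)"
    using set_borel_integral_eq_integral(2)[OF *] hk_kernel_integral[OF assms]
      integral_open_interval[of 0 "pi/2" "hk_kernel x"]
    by (simp add: box_real cbox_interval)
qed

lemma set_integral_sum_mset_hk_kernel:
  fixes E :: "complex multiset"
  assumes "\<And>d. d \<in># E \<Longrightarrow> 0 \<le> Re d \<and> Re d < 1"
  shows "set_integrable lborel quarter (\<lambda>\<theta>. \<Sum>d\<in>#E. hk_kernel (Re d) \<theta>) \<and>
    (LINT \<theta>:quarter|lborel. (\<Sum>d\<in>#E. hk_kernel (Re d) \<theta>)) = pi * ((\<Sum>d\<in>#E. hk_fun (Re d)) - size E * ln 2)"
  using assms
proof (induction E)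
  case empty
  then show ?case by (simp add: set_integrable_def set_lebesgue_integral_def)
next
  case (add d E)
  then have IH: "set_integrable lborel quarter (\<lambda>\<theta>. \<Sum>d\<in>#E. hk_kernel (Re d) \<theta>)"
    "(LINT \<theta>:quarter|lborel. (\<Sum>d\<in>#E. hk_kernel (Re d) \<theta>)) = pi * ((\<Sum>d\<in>#E. hk_fun (Re d)) - size E * ln 2)"
    by auto
  have d: "0 \<le> Re d" "Re d < 1" using add.prems by auto
  show ?case
    using set_integral_add[OF set_integral_hk_kernel(1)[OF d] IH(1)] set_integral_hk_kernel(2)[OF d] IH(2)
    by (simp add: algebra_simps)
qed

lemma eigenvalues_higgs_matrix:
  assumes "admissible_form \<xi> H" "transpose \<xi> = \<xi>" "d \<in># eigenvalues (higgs_matrix \<xi> H)"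
  shows "d = complex_of_real (Re d)" "0 \<le> Re d" "Re d < 1"
proof -
  obtain v where v: "higgs_matrix \<xi> H *v v = d *s v" "v \<noteq> 0"
    using eigenvalue_vector[OF assms(3)] by blast
  obtain r where "d = complex_of_real r" "0 \<le> r" "r < 1"
    using eigenvalue_range[of H \<xi> v d] assms(1,2) v
    unfolding admissible_form_def higgs_matrix_def by blast
  then show "d = complex_of_real (Re d)" "0 \<le> Re d" "Re d < 1" by auto
qed

lemma of_real_prod_mset: "complex_of_real (\<Prod>d\<in>#E. f d) = (\<Prod>d\<in>#E. complex_of_real (f d))"
  by (induction E) auto

lemma det_higgs_matrix:
  assumes "admissible_form \<xi> H" "transpose \<xi> = \<xi>"
  shows "det (mat 1 - c *\<^sub>R higgs_matrix \<xi> H) =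
    complex_of_real (\<Prod>d\<in>#eigenvalues (higgs_matrix \<xi> H). 1 - Re d * c)"
proof -
  have "det (mat 1 - c *\<^sub>R higgs_matrix \<xi> H) = (\<Prod>d\<in>#eigenvalues (higgs_matrix \<xi> H). complex_of_real (1 - Re d * c))"
    unfolding det_one_minus_eigenvalues
    using eigenvalues_higgs_matrix(1)[OF assms]
    by (intro arg_cong[where f = prod_mset] image_mset_cong) (simp add: mult.commute)
  also have "\<dots> = complex_of_real (\<Prod>d\<in>#eigenvalues (higgs_matrix \<xi> H). 1 - Re d * c)"
    by (rule of_real_prod_mset[symmetric])
  finally show ?thesis .
qed

lemma ln_prod_mset:
  assumes "\<And>d. d \<in># E \<Longrightarrow> f d > (0::real)"
  shows "ln (\<Prod>d\<in>#E. f d) = (\<Sum>d\<in>#E. ln (f d)) \<and> (\<Prod>d\<in>#E. f d) > 0"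
  using assms
proof (induction E)
  case (add d E)
  then have "ln (\<Prod>d\<in>#E. f d) = (\<Sum>d\<in>#E. ln (f d))" "(\<Prod>d\<in>#E. f d) > 0" "f d > 0"
    by auto
  then show ?case by (simp add: ln_mult_pos)
qed simp

lemma det_kernel_eq:
  assumes "admissible_form \<xi> H" "transpose \<xi> = \<xi>" "\<theta> \<in> quarter"
  shows "det_kernel \<xi> H \<theta> = (\<Sum>d\<in>#eigenvalues (higgs_matrix \<xi> H). hk_kernel (Re d) \<theta>)"
proof -
  have c: "cos \<theta> \<noteq> 0" using assms(3) cos_gt_zero[of \<theta>] by auto
  have "ln (\<Prod>d\<in>#eigenvalues (higgs_matrix \<xi> H). 1 - Re d * (cos \<theta>)\<^sup>2) =
      (\<Sum>d\<in>#eigenvalues (higgs_matrix \<xi> H). ln (1 - Re d * (cos \<theta>)\<^sup>2))"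
  proof (rule conjunct1[OF ln_prod_mset])
    fix d assume "d \<in># eigenvalues (higgs_matrix \<xi> H)"
    then have "Re d < 1" by (rule eigenvalues_higgs_matrix(3)[OF assms(1,2)])
    then show "1 - Re d * (cos \<theta>)\<^sup>2 > 0" using mult_cos_square_less_one[of "Re d" \<theta>] by simp
  qed
  then have "det_kernel \<xi> H \<theta> = - ((tan \<theta>)\<^sup>2 * (\<Sum>d\<in>#eigenvalues (higgs_matrix \<xi> H). ln (1 - Re d * (cos \<theta>)\<^sup>2)))"
    by (simp add: det_kernel_def det_higgs_matrix[OF assms(1,2)])
  also have "\<dots> = (\<Sum>d\<in>#eigenvalues (higgs_matrix \<xi> H). - ((tan \<theta>)\<^sup>2 * ln (1 - Re d * (cos \<theta>)\<^sup>2)))"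
    using sum_mset_distrib_left[of "- (tan \<theta>)\<^sup>2"] by simp
  finally show ?thesis using c by (simp add: hk_kernel_eq)
qed

text \<open>The scalar formula summed over the n eigenvalues, each contributing one log 2.\<close>

lemma hk_rho_eq:
  fixes \<xi> :: "complex ^ 'n ^ 'n"
  assumes "admissible_form \<xi> H" "transpose \<xi> = \<xi>"
  shows "set_integrable lborel quarter (det_kernel \<xi> H)"
    and "hk_rho (higgs_matrix \<xi> H) = CARD('n) * ln 2 + (LINT \<theta>:quarter|lborel. det_kernel \<xi> H \<theta>) / pi"
proof -
  let ?E = "eigenvalues (higgs_matrix \<xi> H)"
  have *: "set_integrable lborel quarter (\<lambda>\<theta>. \<Sum>d\<in>#?E. hk_kernel (Re d) \<theta>) \<and>
    (LINT \<theta>:quarter|lborel. (\<Sum>d\<in>#?E. hk_kernel (Re d) \<theta>)) = pi * ((\<Sum>d\<in>#?E. hk_fun (Re d)) - size ?E * ln 2)"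
    using eigenvalues_higgs_matrix(2,3)[OF assms] by (intro set_integral_sum_mset_hk_kernel) auto
  show "set_integrable lborel quarter (det_kernel \<xi> H)"
    using * by (subst set_integrable_cong[OF refl refl det_kernel_eq[OF assms]]) auto
  have "(LINT \<theta>:quarter|lborel. det_kernel \<xi> H \<theta>) = (LINT \<theta>:quarter|lborel. (\<Sum>d\<in>#?E. hk_kernel (Re d) \<theta>))"
    by (intro set_lebesgue_integral_cong) (auto simp: det_kernel_eq[OF assms])
  then show "hk_rho (higgs_matrix \<xi> H) = CARD('n) * ln 2 + (LINT \<theta>:quarter|lborel. det_kernel \<xi> H \<theta>) / pi"
    using * by (simp add: hk_rho_def size_eigenvalues)
qed

section \<open>The energy density as an average over \<theta>\<close>

definition hk_density :: "complex ^ 'n ^ 'n \<Rightarrow> real ^ 'n ^ 'n \<Rightarrow> real" where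
  "hk_density \<xi> H = - (1/2) * ln (det H) + (1/2) * hk_rho (higgs_matrix \<xi> H)"

text \<open>The factor 2 fits the interval length: (1/(2 pi)) (pi/2) 2 log det H is the term (1/2)
  log det H of the density.\<close>

definition density_kernel :: "complex ^ 'n ^ 'n \<Rightarrow> real ^ 'n ^ 'n \<Rightarrow> real \<Rightarrow> real" where
  "density_kernel \<xi> H \<theta> = det_kernel \<xi> H \<theta> - 2 * ln (det H)"

lemma hk_density_eq:
  fixes \<xi> :: "complex ^ 'n ^ 'n"
  assumes "admissible_form \<xi> H" "transpose \<xi> = \<xi>"
  shows "set_integrable lborel quarter (density_kernel \<xi> H)"
    and "hk_density \<xi> H = CARD('n) * ln 2 / 2 + (LINT \<theta>:quarter|lborel. density_kernel \<xi> H \<theta>) / (2 * pi)"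
proof -
  have const: "set_integrable lborel quarter (\<lambda>_. 2 * ln (det H))"
    by (simp add: set_integrable_def)
  show "set_integrable lborel quarter (density_kernel \<xi> H)"
    unfolding density_kernel_def by (intro set_integral_diff hk_rho_eq(1) assms const)
  have e: "(LINT \<theta>:quarter|lborel. density_kernel \<xi> H \<theta>) = (LINT \<theta>:quarter|lborel. det_kernel \<xi> H \<theta>) - pi * ln (det H)"
    unfolding density_kernel_def set_integral_diff(2)[OF hk_rho_eq(1)[OF assms] const]
    by (simp add: set_lebesgue_integral_def)
  show "hk_density \<xi> H = CARD('n) * ln 2 / 2 + (LINT \<theta>:quarter|lborel. density_kernel \<xi> H \<theta>) / (2 * pi)"
    unfolding hk_density_def hk_rho_eq(2)[OF assms] e
    by (simp add: diff_divide_distrib add_divide_distrib)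
qed

text \<open>Since tan^2 \<theta> = (1-\<alpha>^2)/\<alpha>^2 cancels the coefficient in
  \<open>log_det_strictly_convex\<close>, and the doubled matrix has determinant (det H)^2, the
  kernel along the segment is tan^2 \<theta> times the strictly convex function w.\<close>

lemma density_kernel_strictly_convex:
  fixes \<xi> :: "complex ^ 'n ^ 'n"
  assumes adm: "\<And>t. 0 \<le> t \<Longrightarrow> t \<le> 1 \<Longrightarrow> admissible_form \<xi> (H + t *\<^sub>R K)"
    and sym: "transpose \<xi> = \<xi>" and K: "transpose K = K" "K \<noteq> 0"
    and \<theta>: "\<theta> \<in> quarter" and t: "0 < t" "t < 1"
  shows "density_kernel \<xi> (H + t *\<^sub>R K) \<theta> <
    (1 - t) * density_kernel \<xi> H \<theta> + t * density_kernel \<xi> (H + K) \<theta>"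
proof -
  define V where "V = real_block \<xi>"
  define \<alpha> where "\<alpha> = cos \<theta>"
  have \<alpha>: "0 < \<alpha>" "\<alpha> < 1"
    using \<theta> cos_gt_zero[of \<theta>] cos_monotone_0_pi[of 0 \<theta>] by (auto simp: \<alpha>_def)
  have s: "(sin \<theta>)\<^sup>2 = 1 - \<alpha>\<^sup>2" by (simp add: \<alpha>_def sin_squared_eq)
  have s0: "1 - \<alpha>\<^sup>2 > 0" using \<alpha> by (simp add: power_less_one_iff)
  have tan: "(tan \<theta>)\<^sup>2 = (1 - \<alpha>\<^sup>2) / \<alpha>\<^sup>2" by (simp add: tan_def power_divide s \<alpha>_def)
  have D: "diag_block (H + t *\<^sub>R K) = diag_block H + t *\<^sub>R diag_block K" for t
    by (simp add: diag_block_def vec_eq_iff all_sum_type)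
  define w where "w = (\<lambda>t. - ln (det (mat 1 + \<alpha> *\<^sub>R V ** (diag_block H + t *\<^sub>R diag_block K)))
      - \<alpha>\<^sup>2 / (1 - \<alpha>\<^sup>2) * ln (det (diag_block H + t *\<^sub>R diag_block K)))"
  have w: "density_kernel \<xi> (H + t *\<^sub>R K) \<theta> = (tan \<theta>)\<^sup>2 * w t" if "0 \<le> t" "t \<le> 1" for t
  proof -
    have "det (H + t *\<^sub>R K) > 0"
      using adm[OF that] pos_definite_det_pos by (auto simp: admissible_form_def)
    moreover have "Re (det (mat 1 - \<alpha>\<^sup>2 *\<^sub>R higgs_matrix \<xi> (H + t *\<^sub>R K))) =
        det (mat 1 + \<alpha> *\<^sub>R V ** (diag_block H + t *\<^sub>R diag_block K))"
      using det_real_block[of \<alpha> \<xi> "H + t *\<^sub>R K"]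
      by (metis D Re_complex_of_real V_def higgs_matrix_def)
    moreover have "ln (det (diag_block H + t *\<^sub>R diag_block K)) = 2 * ln (det (H + t *\<^sub>R K))"
      using calculation(1) by (simp add: D[symmetric] det_diag_block ln_realpow)
    moreover have "p * (- x - q * y) = - (p * x) - y" if "p * q = 1" for p q x y :: real
      using that by (simp add: right_diff_distrib mult.assoc[symmetric])
    moreover have "(1 - \<alpha>\<^sup>2) / \<alpha>\<^sup>2 * (\<alpha>\<^sup>2 / (1 - \<alpha>\<^sup>2)) = 1"
      using \<alpha> s0 by simp
    ultimately show ?thesis
      unfolding density_kernel_def det_kernel_def w_def tan \<alpha>_def[symmetric] by metis
  qed
  have "w t < (1 - t) * w 0 + t * w 1"
    unfolding w_def
  proof (rule log_det_strictly_convex[OF _ _ \<alpha>])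
    show "pos_definite (diag_block H + t *\<^sub>R diag_block K)" if "0 \<le> t" "t \<le> 1" for t
      using adm[OF that] by (simp add: D[symmetric] admissible_form_def pos_definite_diag_block)
    show "transpose V = V"
      using sym unfolding V_def real_block_def transpose_block_matrix
      by (simp add: transpose_def vec_eq_iff all_sum_type)
    show "\<bar>x \<bullet> ((diag_block H + t *\<^sub>R diag_block K) ** V ** (diag_block H + t *\<^sub>R diag_block K) *v x)\<bar>
         < x \<bullet> ((diag_block H + t *\<^sub>R diag_block K) *v x)" if "0 \<le> t" "t \<le> 1" "x \<noteq> 0" for t x
      using adm[OF that(1,2)] real_block_form_less[OF _ sym _ that(3), of "H + t *\<^sub>R K"]
      by (simp add: D[symmetric] V_def admissible_form_def higgs_matrix_def)
    show "transpose (diag_block K) = diag_block K"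
      using K(1) unfolding diag_block_def transpose_block_matrix
      by (simp add: transpose_def vec_eq_iff all_sum_type)
    show "diag_block K \<noteq> 0"
      using K(2) by (auto simp: diag_block_def vec_eq_iff all_sum_type)
  qed (use t in auto)
  moreover have "(tan \<theta>)\<^sup>2 > 0" using tan \<alpha> s0 by simp
  ultimately have "(tan \<theta>)\<^sup>2 * w t < (tan \<theta>)\<^sup>2 * ((1 - t) * w 0 + t * w 1)" by simp
  then show ?thesis
    using w[of t] w[of 0] w[of 1] t by (simp add: algebra_simps)
qed

lemma set_integral_strict_mono:
  fixes f g :: "real \<Rightarrow> real"
  assumes f: "set_integrable lborel {a<..<b} f" and g: "set_integrable lborel {a<..<b} g"
    and less: "\<And>x. x \<in> {a<..<b} \<Longrightarrow> f x < g x" and "a < b"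
  shows "(LINT x:{a<..<b}|lborel. f x) < (LINT x:{a<..<b}|lborel. g x)"
proof -
  define h where "h = (\<lambda>x. indicator {a<..<b} x * (g x - f x))"
  have int: "integrable lborel h"
    using set_integral_diff(1)[OF g f] by (simp add: h_def set_integrable_def)
  have nonneg: "h x \<ge> 0" for x
    using less[of x] by (auto simp: h_def indicator_def)
  have "integral\<^sup>L lborel h \<noteq> 0"
  proof
    assume "integral\<^sup>L lborel h = 0"
    then have "AE x in lborel. h x = 0"
      using integral_nonneg_eq_0_iff_AE[OF int] nonneg by auto
    then have "AE x in lborel. x \<notin> {a<..<b}"
      by (rule AE_mp) (use less in \<open>fastforce simp: h_def indicator_def\<close>)
    then have "emeasure lborel {a<..<b} = 0"
      by (subst (asm) AE_iff_measurable[of "{a<..<b}"]) auto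
    with \<open>a < b\<close> show False by simp
  qed
  moreover have "integral\<^sup>L lborel h \<ge> 0" using nonneg by simp
  moreover have "integral\<^sup>L lborel h = (LINT x:{a<..<b}|lborel. g x) - (LINT x:{a<..<b}|lborel. f x)"
    using set_integral_diff(2)[OF g f] by (simp add: h_def set_lebesgue_integral_def)
  ultimately show ?thesis by simp
qed

lemma hk_density_strictly_convex:
  fixes \<xi> :: "complex ^ 'n ^ 'n"
  assumes adm: "\<And>t. 0 \<le> t \<Longrightarrow> t \<le> 1 \<Longrightarrow> admissible_form \<xi> (H + t *\<^sub>R K)"
    and sym: "transpose \<xi> = \<xi>" and K: "transpose K = K" "K \<noteq> 0" and t: "0 < t" "t < 1"
  shows "hk_density \<xi> (H + t *\<^sub>R K) < (1 - t) * hk_density \<xi> H + t * hk_density \<xi> (H + K)"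
proof -
  have a: "admissible_form \<xi> H" "admissible_form \<xi> (H + K)" "admissible_form \<xi> (H + t *\<^sub>R K)"
    using adm[of 0] adm[of 1] adm[of t] t by auto
  note i = hk_density_eq(1)[OF a(1) sym] hk_density_eq(1)[OF a(2) sym] hk_density_eq(1)[OF a(3) sym]
  have j: "set_integrable lborel quarter (\<lambda>\<theta>. (1 - t) * density_kernel \<xi> H \<theta>)"
    "set_integrable lborel quarter (\<lambda>\<theta>. t * density_kernel \<xi> (H + K) \<theta>)"
    using i t by auto
  have "(LINT \<theta>:quarter|lborel. density_kernel \<xi> (H + t *\<^sub>R K) \<theta>) <
      (LINT \<theta>:quarter|lborel. (1 - t) * density_kernel \<xi> H \<theta> + t * density_kernel \<xi> (H + K) \<theta>)"
    using density_kernel_strictly_convex[OF adm sym K _ t]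
    by (intro set_integral_strict_mono i set_integral_add j) auto
  also have "\<dots> = (1 - t) * (LINT \<theta>:quarter|lborel. density_kernel \<xi> H \<theta>) + t * (LINT \<theta>:quarter|lborel. density_kernel \<xi> (H + K) \<theta>)"
    unfolding set_integral_add(2)[OF j] by simp
  finally show ?thesis
    unfolding hk_density_eq(2)[OF a(1) sym] hk_density_eq(2)[OF a(2) sym] hk_density_eq(2)[OF a(3) sym]
    using divide_strict_right_mono[of _ _ "2 * pi"]
    by (fastforce simp: algebra_simps add_divide_distrib diff_divide_distrib)
qed

subsection \<open>Smooth periodic functions\<close>

lemma smooth_differentiable: "smooth f \<Longrightarrow> f differentiable (at y)"
  unfolding smooth_def differentiable_on_def by (metis UNIV_I foldr.simps(1) id_apply)

lemma smooth_partial_deriv: "smooth f \<Longrightarrow> smooth (partial_deriv i f)"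
  unfolding smooth_def
proof
  fix idx
  assume "\<forall>idx. foldr partial_deriv idx f differentiable_on UNIV"
  from spec[OF this, of "idx @ [i]"] show "foldr partial_deriv idx (partial_deriv i f) differentiable_on UNIV"
    by simp
qed

lemma smoothI:
  assumes "\<And>y. f differentiable (at y)" "\<And>i. smooth (partial_deriv i f)"
  shows "smooth f"
  unfolding smooth_def
proof
  fix idx
  show "foldr partial_deriv idx f differentiable_on UNIV"
  \<comment> \<open>The last index of the list is differentiated first under \<open>foldr\<close>,
    so the list is split at its end.\<close>
  proof (cases idx rule: rev_cases)
    case Nil
    then show ?thesis using assms(1) by (simp add: differentiable_on_def)
  next
    case (snoc xs i)
    then show ?thesis using assms(2)[of i] by (simp add: smooth_def)
  qed
qed

lemma partial_derivI: "(f has_derivative F) (at y) \<Longrightarrow> partial_deriv i f y = F (axis i 1)"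
  unfolding partial_deriv_def using frechet_derivative_at by metis

lemma partial_deriv_const: "partial_deriv i (\<lambda>_. c) = (\<lambda>_. 0)"
  by (rule ext) (rule partial_derivI[OF has_derivative_const])

lemma smooth_const: "smooth (\<lambda>_ :: real ^ 'n. c)"
proof -
  have "\<exists>d. foldr partial_deriv idx (\<lambda>_ :: real ^ 'n. c) = (\<lambda>_. d)" for idx
    by (induction idx) (auto simp: partial_deriv_const)
  then show ?thesis unfolding smooth_def by (metis differentiable_on_const)
qed

lemma smooth_nth: "smooth (\<lambda>y :: real ^ 'n. y $ i)"
proof (rule smoothI)
  have d: "((\<lambda>y :: real ^ 'n. y $ i) has_derivative (\<lambda>h. h $ i)) (at y)" for y
    by (intro bounded_linear_imp_has_derivative bounded_linear_vec_nth)
  show "(\<lambda>y. y $ i) differentiable at y" for y :: "real ^ 'n"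
    using d differentiableI by blast
  have "partial_deriv j (\<lambda>y :: real ^ 'n. y $ i) = (\<lambda>_. axis j 1 $ i)" for j
    by (rule ext) (rule partial_derivI[OF d])
  then show "smooth (partial_deriv j (\<lambda>y :: real ^ 'n. y $ i))" for j
    by (simp add: smooth_const)
qed

lemma smooth_half_norm_square: "smooth (\<lambda>y :: real ^ 'n. (norm y)\<^sup>2 / 2)"
proof (rule smoothI)
  have d: "((\<lambda>y :: real ^ 'n. (norm y)\<^sup>2 / 2) has_derivative (\<lambda>h. y \<bullet> h)) (at y)" for y
    unfolding power2_norm_eq_inner
    by (auto intro!: derivative_eq_intros simp: inner_commute)
  show "(\<lambda>y. (norm y)\<^sup>2 / 2) differentiable at y" for y :: "real ^ 'n"
    using d differentiableI by blast
  have "partial_deriv j (\<lambda>y :: real ^ 'n. (norm y)\<^sup>2 / 2) = (\<lambda>y. y $ j)" for j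
    by (rule ext) (simp add: partial_derivI[OF d] inner_axis)
  then show "smooth (partial_deriv j (\<lambda>y :: real ^ 'n. (norm y)\<^sup>2 / 2))" for j
    by (simp add: smooth_nth)
qed

lemma partial_deriv_linear_comb:
  fixes f g :: "real ^ 'n \<Rightarrow> real"
  assumes "\<And>y. f differentiable (at y)" "\<And>y. g differentiable (at y)"
  shows "partial_deriv i (\<lambda>y. a * f y + b * g y) = (\<lambda>y. a * partial_deriv i f y + b * partial_deriv i g y)"
proof
  fix y
  have "((\<lambda>y. a * f y + b * g y) has_derivative
      (\<lambda>h. a * frechet_derivative f (at y) h + b * frechet_derivative g (at y) h)) (at y)"
    using assms[of y] unfolding frechet_derivative_works by (auto intro!: derivative_eq_intros)
  then show "partial_deriv i (\<lambda>y. a * f y + b * g y) y = a * partial_deriv i f y + b * partial_deriv i g y"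
    using partial_derivI by (fastforce simp: partial_deriv_def)
qed

lemma foldr_partial_deriv_linear_comb:
  fixes f g :: "real ^ 'n \<Rightarrow> real"
  assumes "smooth f" "smooth g"
  shows "foldr partial_deriv idx (\<lambda>y. a * f y + b * g y) =
    (\<lambda>y. a * foldr partial_deriv idx f y + b * foldr partial_deriv idx g y)"
proof (induction idx)
  case (Cons i idx)
  have "foldr partial_deriv idx f differentiable (at y)" "foldr partial_deriv idx g differentiable (at y)" for y
    using assms by (auto simp: smooth_def differentiable_on_def)
  then show ?case by (simp add: Cons.IH partial_deriv_linear_comb)
qed simp

lemma smooth_linear_comb:
  fixes f g :: "real ^ 'n \<Rightarrow> real"
  assumes "smooth f" "smooth g"
  shows "smooth (\<lambda>y. a * f y + b * g y)"
proof -
  have "foldr partial_deriv idx f differentiable (at y)" "foldr partial_deriv idx g differentiable (at y)" for y idx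
    using assms by (auto simp: smooth_def differentiable_on_def)
  then show ?thesis
    unfolding smooth_def foldr_partial_deriv_linear_comb[OF assms] differentiable_on_def
    by (auto intro!: derivative_intros)
qed

lemma hessian_linear_comb:
  fixes f g :: "real ^ 'n \<Rightarrow> real"
  assumes "smooth f" "smooth g"
  shows "hessian (\<lambda>y. a * f y + b * g y) y = a *\<^sub>R hessian f y + b *\<^sub>R hessian g y"
proof -
  have "hessian h y $ i $ j = foldr partial_deriv [i, j] h y" for h i j
    by (simp add: hessian_def)
  then show ?thesis
    unfolding vec_eq_iff by (simp add: foldr_partial_deriv_linear_comb[OF assms] del: foldr.simps)
qed

lemma continuous_on_hessian:
  assumes "smooth f"
  shows "continuous_on UNIV (hessian f)"
proof -
  have "continuous_on UNIV (\<lambda>y. foldr partial_deriv [i, j] f y)" for i j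
    using assms unfolding smooth_def by (metis differentiable_imp_continuous_on)
  then show ?thesis
    unfolding hessian_def by (intro continuous_on_vec_lambda) simp
qed

lemma partial_deriv_periodic:
  assumes "zn_periodic f" "\<And>y. f differentiable (at y)"
  shows "zn_periodic (partial_deriv i f)"
  unfolding zn_periodic_def
proof (intro allI impI)
  fix y m :: "real ^ 'a"
  assume m: "\<forall>i. m $ i \<in> \<int>"
  define F where "F = frechet_derivative f (at (y + m))"
  have "(f has_derivative F) (at (y + m))"
    unfolding F_def using assms(2) frechet_derivative_works by blast
  then have "((\<lambda>x. f (x + m)) has_derivative (\<lambda>h. F h)) (at y)"
    by (rule has_derivative_compose[where f = "\<lambda>x. x + m" and f' = "\<lambda>h. h", rotated])
       (auto intro!: derivative_eq_intros)
  then have "(f has_derivative F) (at y)"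
    using assms(1) m by (simp add: zn_periodic_def)
  then show "partial_deriv i f (y + m) = partial_deriv i f y"
    using partial_derivI by (fastforce simp: partial_deriv_def F_def)
qed

lemma hessian_periodic:
  assumes "smooth f" "zn_periodic f"
  shows "zn_periodic (hessian f)"
proof -
  have "zn_periodic (partial_deriv i (partial_deriv j f))" for i j
    using assms by (intro partial_deriv_periodic smooth_differentiable smooth_partial_deriv)
  then show ?thesis by (simp add: zn_periodic_def hessian_def)
qed

lemma constant_if_partial_derivs_zero:
  fixes f :: "real ^ 'n \<Rightarrow> real"
  assumes "\<And>y. f differentiable (at y)" "\<And>i y. partial_deriv i f y = 0"
  shows "\<exists>c. \<forall>y. f y = c"
proof -
  have "(f has_derivative (\<lambda>h. 0)) (at y)" for y
  proof -
    have F: "(f has_derivative frechet_derivative f (at y)) (at y)"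
      using assms(1) frechet_derivative_works by blast
    then have "linear (frechet_derivative f (at y))"
      using has_derivative_linear by blast
    moreover have "frechet_derivative f (at y) b = 0" if "b \<in> Basis" for b
      using that assms(2)[of _ y] by (auto simp: Basis_vec_def partial_deriv_def)
    ultimately have "frechet_derivative f (at y) = (\<lambda>h. 0)"
      by (intro linear_eq_stdbasis) (auto simp: linear_zero)
    with F show ?thesis by simp
  qed
  then obtain c where "\<And>y. f y = c"
    using has_derivative_zero_constant[of UNIV f] by auto
  then show ?thesis by blast
qed

text \<open>Each first partial derivative is constant. By the mean value theorem that constant is
  the increment of f over one period in its direction, and the increment is 0.\<close>

lemma periodic_hessian_zero_imp_constant:
  fixes f :: "real ^ 'n \<Rightarrow> real"
  assumes f: "smooth f" "zn_periodic f" and hess: "\<And>y. hessian f y = 0"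
  shows "\<exists>c. \<forall>y. f y = c"
proof (rule constant_if_partial_derivs_zero)
  show diff: "f differentiable at y" for y by (rule smooth_differentiable[OF f(1)])
  fix j y
  have "partial_deriv i (partial_deriv j f) y = 0" for i j y
    using hess[of y] by (simp add: hessian_def vec_eq_iff)
  then obtain c where c: "\<And>y. partial_deriv j f y = c"
    using constant_if_partial_derivs_zero[of "partial_deriv j f"] smooth_differentiable[OF smooth_partial_deriv[OF f(1)]]
    by blast
  have "((\<lambda>s. f (s *\<^sub>R axis j 1)) has_real_derivative c) (at s)" for s
  proof -
    have F: "(f has_derivative frechet_derivative f (at (s *\<^sub>R axis j 1))) (at (s *\<^sub>R axis j 1))"
      using diff frechet_derivative_works by blast
    have "((\<lambda>s. f (s *\<^sub>R axis j 1)) has_derivative (\<lambda>h. frechet_derivative f (at (s *\<^sub>R axis j 1)) (h *\<^sub>R axis j 1))) (at s)"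
      by (rule has_derivative_compose[where f = "\<lambda>s. s *\<^sub>R axis j 1" and g = f, OF _ F])
         (auto intro!: derivative_eq_intros)
    moreover have "frechet_derivative f (at (s *\<^sub>R axis j 1)) (h *\<^sub>R axis j 1) = h * c" for h
      using c[of "s *\<^sub>R axis j 1"] linear_scale[OF has_derivative_linear[OF F]]
      by (simp add: partial_deriv_def)
    ultimately show ?thesis by (simp add: has_field_derivative_def mult_commute_abs)
  qed
  then obtain s where "f (1 *\<^sub>R axis j 1) - f (0 *\<^sub>R axis j 1) = (1 - 0) * c"
    using MVT2[of 0 1 "\<lambda>s. f (s *\<^sub>R axis j 1)" "\<lambda>_. c"] by auto
  moreover have "f (0 + axis j 1) = f 0"
  proof -
    have "\<forall>i. axis j (1 :: real) $ i \<in> \<int>" by (simp add: axis_def)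
    then show ?thesis using f(2) unfolding zn_periodic_def by blast
  qed
  ultimately show "partial_deriv j f y = 0" using c by simp
qed

subsection \<open>Convexity of the energy\<close>

text \<open>With A = (Re \<xi>)H and B = (Im \<xi>)H the matrix is (A + iB)(A - iB), whose mixed
  terms are imaginary. The constraint thus separates into a form in Re \<xi> and a form in Im
  \<xi>.\<close>

lemma Re_trace_higgs_matrix:
  fixes \<xi> :: "complex ^ 'n ^ 'n"
  shows "Re (trace (higgs_matrix \<xi> H)) = trace_form (map_matrix Re \<xi>) H H + trace_form (map_matrix Im \<xi>) H H"
proof -
  let ?A = "map_matrix Re \<xi> ** H" and ?B = "map_matrix Im \<xi> ** H"
  have P: "(\<xi> ** cmat H) $ i $ j = Complex (?A $ i $ j) (?B $ i $ j)" for i j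
    by (simp add: matrix_matrix_mult_def complex_eq_iff)
  have Q: "(map_matrix cnj \<xi> ** cmat H) $ i $ j = Complex (?A $ i $ j) (- ?B $ i $ j)" for i j
    by (simp add: matrix_matrix_mult_def complex_eq_iff sum_negf)
  have "higgs_matrix \<xi> H = (\<xi> ** cmat H) ** (map_matrix cnj \<xi> ** cmat H)"
    by (simp add: higgs_matrix_def matrix_mul_assoc)
  then have "Re (trace (higgs_matrix \<xi> H)) = (\<Sum>i\<in>UNIV. \<Sum>k\<in>UNIV. Re ((\<xi> ** cmat H) $ i $ k * (map_matrix cnj \<xi> ** cmat H) $ k $ i))"
    unfolding trace_def by (simp add: matrix_matrix_mult_def[of "\<xi> ** cmat H"])
  also have "\<dots> = trace (?A ** ?A) + trace (?B ** ?B)"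
    unfolding P Q by (simp add: trace_def matrix_matrix_mult_def[of ?A ?A] matrix_matrix_mult_def[of ?B ?B] sum.distrib)
  also have "\<dots> = trace_form (map_matrix Re \<xi>) H H + trace_form (map_matrix Im \<xi>) H H"
    using trace_mul_sym[of "map_matrix Re \<xi>" "H ** map_matrix Re \<xi> ** H"]
      trace_mul_sym[of "map_matrix Im \<xi>" "H ** map_matrix Im \<xi> ** H"]
    by (simp add: trace_form_def matrix_mul_assoc)
  finally show ?thesis .
qed

text \<open>The expression is quadratic in A, so the negative case follows from the positive one for
  -A.\<close>

lemma trace_form_semidefinite_nonneg:
  assumes "pos_semidefinite A \<or> neg_semidefinite A" "transpose K = K"
  shows "trace_form A K K \<ge> 0"
proof -
  have eq: "trace_form A K K = trace (A ** K ** A ** K)"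
    using trace_mul_sym[of A "K ** A ** K"] by (simp add: trace_form_def matrix_mul_assoc)
  show ?thesis
  proof (cases "pos_semidefinite A")
    case True
    then show ?thesis unfolding eq using trace_psd_nonneg assms(2) by blast
  next
    case False
    then have "neg_semidefinite A" using assms(1) by blast
    moreover have "v \<bullet> (((-1) *\<^sub>R A) *v v) = - (v \<bullet> (A *v v))" for v
      unfolding scaleR_matrix_vector_assoc[symmetric] by simp
    ultimately have "pos_semidefinite ((-1) *\<^sub>R A)"
      unfolding pos_semidefinite_def neg_semidefinite_def by (simp add: transpose_def vec_eq_iff)
    then have "trace (((-1) *\<^sub>R A) ** K ** ((-1) *\<^sub>R A) ** K) \<ge> 0"
      using trace_psd_nonneg assms(2) by blast
    moreover have "(c *\<^sub>R A) ** K ** (c *\<^sub>R A) ** K = (c * c) *\<^sub>R (A ** K ** A ** K)" for c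
      by (simp add: scalar_matrix_assoc[symmetric] matrix_scalar_ac)
    ultimately show ?thesis unfolding eq by (metis minus_mult_minus mult_1 scaleR_one)
  qed
qed

lemma pos_definite_segment:
  fixes H K :: "real ^ 'n ^ 'n"
  assumes "pos_definite H" "pos_definite (H + K)" and t: "0 \<le> t" "t \<le> 1"
  shows "pos_definite (H + t *\<^sub>R K)"
proof -
  have eq: "H + t *\<^sub>R K = (1 - t) *\<^sub>R H + t *\<^sub>R (H + K)" by (simp add: algebra_simps)
  have "0 < v \<bullet> ((H + t *\<^sub>R K) *v v)" if "v \<noteq> 0" for v
  proof -
    have pos: "0 < v \<bullet> (H *v v)" "0 < v \<bullet> ((H + K) *v v)"
      using assms(1,2) that by (auto simp: pos_definite_def)
    have "v \<bullet> ((H + t *\<^sub>R K) *v v) = (1 - t) * (v \<bullet> (H *v v)) + t * (v \<bullet> ((H + K) *v v))"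
      unfolding eq by (simp add: matrix_vector_mult_add_rdistrib scaleR_matrix_vector_assoc[symmetric] inner_add_right)
    also have "\<dots> > 0"
      using pos t by (cases "t = 0") (auto intro: add_nonneg_pos)
    finally show ?thesis .
  qed
  moreover have "transpose (H + t *\<^sub>R K) = H + t *\<^sub>R K"
  proof -
    have "transpose H = H" "transpose (H + K) = H + K"
      using assms(1,2) by (auto simp: pos_definite_def)
    then show ?thesis unfolding eq by (simp add: transpose_def vec_eq_iff)
  qed
  ultimately show ?thesis by (simp add: pos_definite_def)
qed

text \<open>
  This is the only place where the semidefiniteness of the real and imaginary parts enters: it makes
  the quadratic form $\mathrm{Tr}(\xi H\bar\xi H)$ convex in $H$.
\<close>

lemma admissible_form_segment:
  fixes \<xi> :: "complex ^ 'n ^ 'n"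
  assumes re: "pos_semidefinite (map_matrix Re \<xi>) \<or> neg_semidefinite (map_matrix Re \<xi>)"
    and im: "pos_semidefinite (map_matrix Im \<xi>) \<or> neg_semidefinite (map_matrix Im \<xi>)"
    and adm: "admissible_form \<xi> H" "admissible_form \<xi> (H + K)" and t: "0 \<le> t" "t \<le> 1"
  shows "admissible_form \<xi> (H + t *\<^sub>R K)"
proof -
  define a where "a = trace_form (map_matrix Re \<xi>) H H + trace_form (map_matrix Im \<xi>) H H"
  define b where "b = trace_form (map_matrix Re \<xi>) H K + trace_form (map_matrix Im \<xi>) H K"
  define c where "c = trace_form (map_matrix Re \<xi>) K K + trace_form (map_matrix Im \<xi>) K K"
  have q: "Re (trace (higgs_matrix \<xi> (H + s *\<^sub>R K))) = a + 2 * s * b + s\<^sup>2 * c" for s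
    using trace_form_square[of _ 1 H s K]
    by (simp add: Re_trace_higgs_matrix a_def b_def c_def algebra_simps)
  have "transpose H = H" "transpose (H + K) = H + K"
    using adm by (auto simp: admissible_form_def pos_definite_def)
  then have "transpose K = K" by (simp add: transpose_def vec_eq_iff)
  then have c: "c \<ge> 0"
    unfolding c_def using re im by (intro add_nonneg_nonneg trace_form_semidefinite_nonneg)
  have ends: "a < 1" "a + 2 * b + c < 1"
    using adm q[of 0] q[of 1] by (auto simp: admissible_form_def)
  have "a + 2 * t * b + t\<^sup>2 * c = (1 - t) * a + t * (a + 2 * b + c) - (t * (1 - t)) * c"
    by (simp add: algebra_simps power2_eq_square)
  also have "\<dots> \<le> (1 - t) * a + t * (a + 2 * b + c)"
    using c t by simp
  also have "\<dots> < 1"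
    by (intro convex_bound_lt) (use ends t in auto)
  finally have "Re (trace (higgs_matrix \<xi> (H + t *\<^sub>R K))) < 1" by (simp add: q)
  then show ?thesis
    using pos_definite_segment adm t by (auto simp: admissible_form_def)
qed

lemma admissible_imp_form: "u \<in> admissible \<xi> \<Longrightarrow> admissible_form (\<xi> y) (hessian u y)"
  by (simp add: admissible_def admissible_form_def symplectic_potential_def hk_matrix_eq)

lemma admissible_smooth:
  assumes "u \<in> admissible \<xi>"
  shows "smooth u"
proof -
  obtain \<phi> where "smooth \<phi>" "u = (\<lambda>y. (norm y)\<^sup>2 / 2 + \<phi> y)"
    using assms by (auto simp: admissible_def symplectic_potential_def)
  then show ?thesis
    using smooth_linear_comb[OF smooth_half_norm_square, of \<phi> 1 1] by simp
qed

lemma admissible_diff: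
  assumes "u \<in> admissible \<xi>" "v \<in> admissible \<xi>"
  shows "smooth (\<lambda>y. v y - u y)" "zn_periodic (\<lambda>y. v y - u y)"
    and "hessian (\<lambda>y. v y - u y) y = hessian v y - hessian u y"
proof -
  show "smooth (\<lambda>y. v y - u y)"
    using smooth_linear_comb[OF admissible_smooth[OF assms(2)] admissible_smooth[OF assms(1)], of 1 "-1"] by simp
  obtain \<phi> \<psi> where "zn_periodic \<phi>" "u = (\<lambda>y. (norm y)\<^sup>2 / 2 + \<phi> y)"
    "zn_periodic \<psi>" "v = (\<lambda>y. (norm y)\<^sup>2 / 2 + \<psi> y)"
    using assms by (auto simp: admissible_def symplectic_potential_def)
  then show "zn_periodic (\<lambda>y. v y - u y)"
    by (simp add: zn_periodic_def)
  show "hessian (\<lambda>y. v y - u y) y = hessian v y - hessian u y"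
    using hessian_linear_comb[OF admissible_smooth[OF assms(2)] admissible_smooth[OF assms(1)], of 1 "-1" y] by simp
qed

section \<open>Integrability of the energy density\<close>

lemma hk_fun_bounds:
  assumes "0 \<le> x" "x < 1"
  shows "\<bar>hk_fun x\<bar> \<le> 1"
proof -
  define s where "s = sqrt (1 - x)"
  have s: "0 \<le> s" "s \<le> 1" using assms by (auto simp: s_def)
  have "0 \<le> ln (1 + s)" "ln (1 + s) \<le> s"
    using s ln_add_one_self_le_self[of s] by auto
  then show ?thesis using s by (simp add: hk_fun_def flip: s_def)
qed

lemma hk_rho_bound:
  fixes \<xi> :: "complex ^ 'n ^ 'n"
  assumes "admissible_form \<xi> H" "transpose \<xi> = \<xi>"
  shows "\<bar>hk_rho (higgs_matrix \<xi> H)\<bar> \<le> CARD('n)"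
proof -
  have "\<bar>\<Sum>d\<in>#E. hk_fun (Re d)\<bar> \<le> size E" if "\<And>d. d \<in># E \<Longrightarrow> 0 \<le> Re d \<and> Re d < 1" for E :: "complex multiset"
    using that
  proof (induction E)
    case (add d E)
    then have "\<bar>\<Sum>d\<in>#E. hk_fun (Re d)\<bar> \<le> size E" "\<bar>hk_fun (Re d)\<bar> \<le> 1"
      using hk_fun_bounds by auto
    then show ?case by simp
  qed simp
  from this[of "eigenvalues (higgs_matrix \<xi> H)"] show ?thesis
    using eigenvalues_higgs_matrix[OF assms] by (simp add: hk_rho_def size_eigenvalues)
qed

text \<open>Instead of following the eigenvalues as y varies, the proof writes the spectral term as
  an integral over \<theta> of a kernel jointly measurable in y and \<theta>; such parameter
  integrals are measurable in y.\<close>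

lemma measurable_hk_rho:
  fixes \<xi> :: "real ^ 'n \<Rightarrow> complex ^ 'n ^ 'n"
  assumes \<xi>: "continuous_on UNIV \<xi>" "\<And>y. transpose (\<xi> y) = \<xi> y"
    and H: "continuous_on UNIV H" "\<And>y. admissible_form (\<xi> y) (H y)"
  shows "(\<lambda>y. hk_rho (higgs_matrix (\<xi> y) (H y))) \<in> borel_measurable borel"
proof -
  have sets: "sets (borel \<Otimes>\<^sub>M lborel) = sets (borel :: ((real ^ 'n) \<times> real) measure)"
    using sets_pair_measure_cong[OF refl sets_lborel] by (metis borel_prod)
  have "continuous_on UNIV (\<lambda>y. higgs_matrix (\<xi> y) (H y) $ i $ j)" for i j
    unfolding higgs_matrix_def matrix_matrix_mult_def
    by (simp, intro continuous_intros continuous_on_component \<xi>(1) H(1))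
  then have M: "continuous_on UNIV (\<lambda>p :: (real ^ 'n) \<times> real. higgs_matrix (\<xi> (fst p)) (H (fst p)) $ i $ j)" for i j
    by (rule continuous_on_compose2) (auto intro!: continuous_intros)
  have "continuous_on UNIV (\<lambda>p :: (real ^ 'n) \<times> real. (mat 1 - (cos (snd p))\<^sup>2 *\<^sub>R higgs_matrix (\<xi> (fst p)) (H (fst p))) $ i $ j)" for i j
    by (simp, intro continuous_intros M)
  then have "continuous_on UNIV (\<lambda>p :: (real ^ 'n) \<times> real.
      det (mat 1 - (cos (snd p))\<^sup>2 *\<^sub>R higgs_matrix (\<xi> (fst p)) (H (fst p))))"
    by (rule continuous_on_det)
  then have "continuous_on UNIV (\<lambda>p :: (real ^ 'n) \<times> real.
      Re (det (mat 1 - (cos (snd p))\<^sup>2 *\<^sub>R higgs_matrix (\<xi> (fst p)) (H (fst p)))))"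
    by (intro continuous_intros)
  then have [measurable]: "(\<lambda>p :: (real ^ 'n) \<times> real.
      Re (det (mat 1 - (cos (snd p))\<^sup>2 *\<^sub>R higgs_matrix (\<xi> (fst p)) (H (fst p))))) \<in> borel_measurable (borel \<Otimes>\<^sub>M lborel)"
    using borel_measurable_continuous_onI measurable_cong_sets[OF sets refl] by blast
  \<comment> \<open>A quotient of continuous functions is Borel on the whole line, with value 0 at
    the poles.\<close>
  have [measurable]: "tan \<in> borel_measurable (borel :: real measure)"
    unfolding tan_def[abs_def] by (intro borel_measurable_divide borel_measurable_continuous_onI continuous_intros)
  have "(\<lambda>p. indicator quarter (snd p) *\<^sub>R det_kernel (\<xi> (fst p)) (H (fst p)) (snd p)) \<in> borel_measurable (borel \<Otimes>\<^sub>M lborel)"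
    unfolding det_kernel_def by measurable
  then have "(\<lambda>y. LINT \<theta>:quarter|lborel. det_kernel (\<xi> y) (H y) \<theta>) \<in> borel_measurable borel"
    unfolding set_lebesgue_integral_def
    by (intro lborel.borel_measurable_lebesgue_integral) (simp add: split_beta')
  then show ?thesis
    using hk_rho_eq(2)[OF H(2) \<xi>(2)] by simp
qed

text \<open>Bochner integrals of non-integrable functions default to 0, so the two integrals in the
  energy may be merged only after each is shown to exist: the first by continuity, the second by
  measurability and the bound n.\<close>

lemma set_integrable_hk_density:
  fixes \<xi> :: "real ^ 'n \<Rightarrow> complex ^ 'n ^ 'n"
  assumes "higgs_tensor \<xi>" "u \<in> admissible \<xi>"
  shows "set_integrable lborel (cbox 0 1) (\<lambda>y. hk_density (\<xi> y) (hessian u y))"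
    and "hk_energy u \<xi> = (LINT y:cbox 0 1|lborel. hk_density (\<xi> y) (hessian u y))"
proof -
  have sym: "transpose (\<xi> y) = \<xi> y" for y using assms(1) by (simp add: higgs_tensor_def)
  have cont: "continuous_on UNIV \<xi>"
    using assms(1) unfolding higgs_tensor_def
    by (meson continuous_at_imp_continuous_on differentiable_imp_continuous_within smooth_differentiable)
  note adm = admissible_imp_form[OF assms(2)]
  note H = continuous_on_hessian[OF admissible_smooth[OF assms(2)]]
  have "det (hessian u y) > 0" for y
    using adm[of y] pos_definite_det_pos by (auto simp: admissible_form_def)
  then have "det (hessian u y) \<noteq> 0" for y by (metis less_irrefl)
  moreover have "continuous_on UNIV (\<lambda>y. det (hessian u y))"
    by (intro continuous_on_det continuous_on_component H)
  ultimately have "continuous_on UNIV (\<lambda>y. ln (det (hessian u y)))"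
    by (intro continuous_on_ln) auto
  then have "continuous_on (cbox 0 1) (\<lambda>y. ln (det (hessian u y)))"
    by (rule continuous_on_subset) simp
  then have 1: "set_integrable lborel (cbox 0 1) (\<lambda>y. ln (det (hessian u y)))"
    unfolding set_integrable_def by (intro borel_integrable_compact compact_cbox)
  have 2: "set_integrable lborel (cbox 0 1) (\<lambda>y. hk_rho (hk_matrix u \<xi> y))"
  proof (rule set_integrable_bound)
    show "set_integrable lborel (cbox 0 (1 :: real ^ 'n)) (\<lambda>_. real CARD('n))"
      unfolding set_integrable_def by (intro borel_integrable_compact compact_cbox continuous_on_const)
    show "set_borel_measurable lborel (cbox 0 1) (\<lambda>y. hk_rho (hk_matrix u \<xi> y))"
      using measurable_hk_rho[OF cont sym H adm]
      by (simp add: set_borel_measurable_def hk_matrix_eq)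
    show "AE y in lborel. y \<in> cbox 0 1 \<longrightarrow> norm (hk_rho (hk_matrix u \<xi> y)) \<le> norm (real CARD('n))"
      using hk_rho_bound[OF adm sym] by (simp add: hk_matrix_eq)
  qed
  have 3: "set_integrable lborel (cbox 0 1) (\<lambda>y. - (1/2) * ln (det (hessian u y)))"
    "set_integrable lborel (cbox 0 1) (\<lambda>y. (1/2) * hk_rho (hk_matrix u \<xi> y))"
    using 1 2 by (intro set_integrable_mult_right; simp)+
  show "set_integrable lborel (cbox 0 1) (\<lambda>y. hk_density (\<xi> y) (hessian u y))"
    using set_integral_add(1)[OF 3] by (simp add: hk_density_def hk_matrix_eq)
  show "hk_energy u \<xi> = (LINT y:cbox 0 1|lborel. hk_density (\<xi> y) (hessian u y))"
    using set_integral_add(2)[OF 3]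
    unfolding set_integral_mult_right hk_density_def hk_energy_def hk_matrix_eq by (simp only:)
qed

section \<open>Convexity along segments, minimality and uniqueness\<close>

context
  fixes \<xi> :: "real ^ 'n \<Rightarrow> complex ^ 'n ^ 'n"
  assumes higgs: "higgs_tensor \<xi>"
    and re: "semidefinite_field (\<lambda>y. map_matrix Re (\<xi> y))"
    and im: "semidefinite_field (\<lambda>y. map_matrix Im (\<xi> y))"
begin

lemma admissible_form_between:
  assumes "u \<in> admissible \<xi>" "v \<in> admissible \<xi>" "0 \<le> t" "t \<le> 1"
  shows "admissible_form (\<xi> y) (hessian u y + t *\<^sub>R (hessian v y - hessian u y))"
proof (rule admissible_form_segment)
  show "admissible_form (\<xi> y) (hessian u y + (hessian v y - hessian u y))"
    using admissible_imp_form[OF assms(2)] by simp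
qed (use re im assms admissible_imp_form in \<open>auto simp: semidefinite_field_def\<close>)

lemma segment_hessian:
  assumes "u \<in> admissible \<xi>" "v \<in> admissible \<xi>"
  shows "hessian (\<lambda>y. u y + t * (v y - u y)) y = hessian u y + t *\<^sub>R (hessian v y - hessian u y)"
  using hessian_linear_comb[OF admissible_smooth[OF assms(1)] admissible_diff(1)[OF assms], of 1 t y]
  by (simp add: admissible_diff(3)[OF assms])

lemma segment_admissible:
  assumes "u \<in> admissible \<xi>" "v \<in> admissible \<xi>" "0 \<le> t" "t \<le> 1"
  shows "(\<lambda>y. u y + t * (v y - u y)) \<in> admissible \<xi>"
proof -
  obtain \<phi> where \<phi>: "smooth \<phi>" "zn_periodic \<phi>" "u = (\<lambda>y. (norm y)\<^sup>2 / 2 + \<phi> y)"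
    using assms(1) by (auto simp: admissible_def symplectic_potential_def)
  let ?\<psi> = "\<lambda>y. 1 * \<phi> y + t * (v y - u y)"
  have "smooth ?\<psi>" by (intro smooth_linear_comb \<phi> admissible_diff(1)[OF assms(1,2)])
  moreover have "zn_periodic ?\<psi>"
    using \<phi>(2) admissible_diff(2)[OF assms(1,2)] by (simp add: zn_periodic_def)
  moreover have "(\<lambda>y. u y + t * (v y - u y)) = (\<lambda>y. (norm y)\<^sup>2 / 2 + ?\<psi> y)"
    by (rule ext) (simp add: \<phi>(3))
  ultimately show ?thesis
    using admissible_form_between[OF assms]
    unfolding admissible_def mem_Collect_eq symplectic_potential_def admissible_form_def hk_matrix_eq
      segment_hessian[OF assms(1,2)] by blast
qed

lemma hk_density_segment:
  assumes "u \<in> admissible \<xi>" "v \<in> admissible \<xi>" "0 < t" "t < 1"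
  shows "hk_density (\<xi> y) (hessian (\<lambda>y. u y + t * (v y - u y)) y) \<le>
      (1 - t) * hk_density (\<xi> y) (hessian u y) + t * hk_density (\<xi> y) (hessian v y)"
    and "hessian u y \<noteq> hessian v y \<Longrightarrow> hk_density (\<xi> y) (hessian (\<lambda>y. u y + t * (v y - u y)) y) <
      (1 - t) * hk_density (\<xi> y) (hessian u y) + t * hk_density (\<xi> y) (hessian v y)"
proof -
  have "transpose (hessian u y) = hessian u y" "transpose (hessian v y) = hessian v y"
    using admissible_imp_form assms by (auto simp: admissible_form_def pos_definite_def)
  then have "transpose (hessian v y - hessian u y) = hessian v y - hessian u y"
    by (simp add: transpose_def vec_eq_iff)
  then show strict: "hk_density (\<xi> y) (hessian (\<lambda>y. u y + t * (v y - u y)) y) <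
      (1 - t) * hk_density (\<xi> y) (hessian u y) + t * hk_density (\<xi> y) (hessian v y)" if "hessian u y \<noteq> hessian v y"
    using hk_density_strictly_convex[OF admissible_form_between[OF assms(1,2)], of y t] higgs that assms(3,4)
    by (simp add: higgs_tensor_def segment_hessian[OF assms(1,2)])
  show "hk_density (\<xi> y) (hessian (\<lambda>y. u y + t * (v y - u y)) y) \<le>
      (1 - t) * hk_density (\<xi> y) (hessian u y) + t * hk_density (\<xi> y) (hessian v y)"
  proof (cases "hessian u y = hessian v y")
    case True
    then show ?thesis
      unfolding segment_hessian[OF assms(1,2)] by (simp add: left_diff_distrib)
  next
    case False
    then show ?thesis using strict by simp
  qed
qed

text \<open>Pointwise convexity integrates to the inequality. In the equality case the nonnegative
  gap \<open>g\<close> vanishes almost everywhere on the cube, while it is positive wherever the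
  Hessians differ.\<close>

lemma hk_energy_segment:
  assumes "u \<in> admissible \<xi>" "v \<in> admissible \<xi>" "0 < t" "t < 1"
  shows "hk_energy (\<lambda>y. u y + t * (v y - u y)) \<xi> \<le> (1 - t) * hk_energy u \<xi> + t * hk_energy v \<xi>"
    and "hk_energy (\<lambda>y. u y + t * (v y - u y)) \<xi> = (1 - t) * hk_energy u \<xi> + t * hk_energy v \<xi> \<Longrightarrow>
      \<exists>c. \<forall>y. v y = u y + c"
proof -
  let ?w = "\<lambda>y. u y + t * (v y - u y)"
  let ?d = "\<lambda>u y. hk_density (\<xi> y) (hessian u y)"
  have w: "?w \<in> admissible \<xi>" using segment_admissible assms by simp
  note int = set_integrable_hk_density(1)[OF higgs] and energy = set_integrable_hk_density(2)[OF higgs]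
  define g where "g = (\<lambda>y. (1 - t) * ?d u y + t * ?d v y - ?d ?w y)"
  have s: "set_integrable lborel (cbox 0 1) (\<lambda>y. (1 - t) * ?d u y)" "set_integrable lborel (cbox 0 1) (\<lambda>y. t * ?d v y)"
    using int[OF assms(1)] int[OF assms(2)] by auto
  note s2 = set_integral_add[OF s]
  have gint: "set_integrable lborel (cbox 0 1) g"
    unfolding g_def by (intro set_integral_diff s2 int w)
  have "(LINT y:cbox 0 1|lborel. g y) = (LINT y:cbox 0 1|lborel. (1 - t) * ?d u y + t * ?d v y) - hk_energy ?w \<xi>"
    unfolding g_def energy[OF w] by (intro set_integral_diff s2 int w)
  also have "(LINT y:cbox 0 1|lborel. (1 - t) * ?d u y + t * ?d v y) = (1 - t) * hk_energy u \<xi> + t * hk_energy v \<xi>"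
    unfolding s2(2) by (simp add: energy assms(1,2))
  finally have G: "(LINT y:cbox 0 1|lborel. g y) = (1 - t) * hk_energy u \<xi> + t * hk_energy v \<xi> - hk_energy ?w \<xi>" .
  have g0: "g y \<ge> 0" for y using hk_density_segment(1)[OF assms, of y] by (simp add: g_def)
  then have "(LINT y:cbox 0 1|lborel. g y) \<ge> 0"
    unfolding set_lebesgue_integral_def by (intro integral_nonneg_AE) (simp add: indicator_def)
  with G show "hk_energy ?w \<xi> \<le> (1 - t) * hk_energy u \<xi> + t * hk_energy v \<xi>" by simp
  assume "hk_energy ?w \<xi> = (1 - t) * hk_energy u \<xi> + t * hk_energy v \<xi>"
  then have "integral\<^sup>L lborel (\<lambda>y. indicator (cbox 0 1) y *\<^sub>R g y) = 0"
    using G by (simp add: set_lebesgue_integral_def)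
  then have "AE y in lborel. indicator (cbox 0 1) y *\<^sub>R g y = 0"
    using integral_nonneg_eq_0_iff_AE[OF gint[unfolded set_integrable_def]] g0 by (auto simp: indicator_def)
  then have ae: "AE y in lborel. y \<in> cbox 0 1 \<longrightarrow> g y = 0"
    by (rule AE_mp) (auto simp: indicator_def)
  define \<delta> where "\<delta> = (\<lambda>y. v y - u y)"
  note \<delta> = admissible_diff[OF assms(1,2), folded \<delta>_def]
  \<comment> \<open>The argument runs through the set where the Hessians differ, which is open by
    continuity of the Hessians; no continuity of the gap is required. A nonempty open set is not
    null.\<close>
  define D where "D = {y. hessian \<delta> y \<noteq> 0}"
  have openD: "open D"
    unfolding D_def by (intro open_Collect_neq continuous_on_hessian \<delta> continuous_on_const)
  have gpos: "g y > 0" if "y \<in> D" for y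
    using hk_density_segment(2)[OF assms, of y] that by (auto simp: g_def D_def \<delta>(3))
  have "D \<inter> box 0 1 = {}"
  proof (rule ccontr)
    assume ne: "D \<inter> box 0 1 \<noteq> {}"
    have "AE y in lborel. y \<notin> D \<inter> box 0 1"
      using ae by (rule AE_mp) (use gpos box_subset_cbox in \<open>fastforce\<close>)
    then have "emeasure lborel (D \<inter> box 0 1) = 0"
      using openD by (subst (asm) AE_iff_measurable[of "D \<inter> box 0 1"]) auto
    then have "negligible (D \<inter> box 0 1)"
      using openD by (intro negligible_iff_null_sets[THEN iffD2] null_sets_completionI) (auto simp: null_sets_def)
    then show False
      using open_not_negligible[of "D \<inter> box 0 1"] openD ne by auto
  qed
  \<comment> \<open>The midpoint shows that the open box is nonempty, so its closure is the cube; an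
    open set that misses the box also misses the closure.\<close>
  moreover have "(\<chi> i. 1 / 2) \<in> box 0 (1 :: real ^ 'n)" by (simp add: mem_box_cart)
  then have "closure (box 0 1) = cbox 0 (1 :: real ^ 'n)" by (intro closure_box) blast
  ultimately have cubeD: "D \<inter> cbox 0 1 = {}"
    using open_Int_closure_eq_empty[OF openD, of "box 0 1"] by simp
  have "hessian \<delta> y = 0" for y
  proof -
    \<comment> \<open>The integer translation that brings y into the cube.\<close>
    define m :: "real ^ 'n" where "m = (\<chi> i. of_int \<lfloor>y $ i\<rfloor>)"
    have "y - m \<in> cbox 0 1"
      by (auto simp: mem_box_cart m_def) linarith+
    then have "hessian \<delta> (y - m) = 0" using cubeD by (auto simp: D_def)
    moreover have "\<forall>i. m $ i \<in> \<int>" by (simp add: m_def)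
    then have "hessian \<delta> (y - m + m) = hessian \<delta> (y - m)"
      using hessian_periodic[OF \<delta>(1,2)] unfolding zn_periodic_def by blast
    ultimately show ?thesis by simp
  qed
  then obtain c where "\<And>y. \<delta> y = c"
    using periodic_hessian_zero_imp_constant[OF \<delta>(1,2)] by blast
  then have "\<forall>y. v y = u y + c" by (simp add: \<delta>_def algebra_simps)
  then show "\<exists>c. \<forall>y. v y = u y + c" by blast
qed

text \<open>The difference of two admissible potentials is a legitimate test function. Convexity
  bounds the difference quotients along the segment towards v by F(v) - F(u), and by criticality
  they tend to 0.\<close>

lemma extremal_imp_minimum:
  assumes "hk_extremal \<xi> u"
  shows "hk_minimum \<xi> u"
  unfolding hk_minimum_def
proof (intro conjI ballI)
  show u: "u \<in> admissible \<xi>" using assms by (simp add: hk_extremal_def)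
  fix v assume v: "v \<in> admissible \<xi>"
  define g where "g = (\<lambda>t. hk_energy (\<lambda>y. u y + t * (v y - u y)) \<xi>)"
  have "(g has_real_derivative 0) (at 0)"
    using assms admissible_diff(1,2)[OF u v] unfolding hk_extremal_def g_def by blast
  then have "((\<lambda>t. (g t - g 0) / (t - 0)) \<longlongrightarrow> 0) (at 0)"
    by (simp add: has_field_derivative_iff)
  \<comment> \<open>One-sided, because the segment and its convexity bound exist only for positive
    t.\<close>
  then have "((\<lambda>t. (g t - g 0) / (t - 0)) \<longlongrightarrow> 0) (at_right 0)"
    by (rule filterlim_mono) (auto intro: at_le)
  moreover have "\<forall>\<^sub>F t in at_right 0. (g t - g 0) / (t - 0) \<le> hk_energy v \<xi> - g 0"
    unfolding eventually_at_right_field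
  proof (intro exI[of _ 1] conjI allI impI)
    fix t :: real assume t: "0 < t" "t < 1"
    have "g t \<le> (1 - t) * g 0 + t * hk_energy v \<xi>"
      using hk_energy_segment(1)[OF u v t] by (simp add: g_def)
    then show "(g t - g 0) / (t - 0) \<le> hk_energy v \<xi> - g 0"
      using t by (simp add: field_simps)
  qed simp
  ultimately have "0 \<le> hk_energy v \<xi> - g 0"
    using tendsto_upperbound by (metis trivial_limit_at_right_real)
  then show "hk_energy u \<xi> \<le> hk_energy v \<xi>" by (simp add: g_def)
qed

text \<open>Both potentials are minima and so have equal energy. Minimality and convexity squeeze
  the energy of their midpoint to the same value, which is the equality case of convexity.\<close>

lemma extremal_unique:
  assumes "hk_extremal \<xi> u" "hk_extremal \<xi> v"
  shows "\<exists>c. \<forall>y. v y = u y + c"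
proof -
  have adm: "u \<in> admissible \<xi>" "v \<in> admissible \<xi>" using assms by (auto simp: hk_extremal_def)
  have min: "hk_minimum \<xi> u" "hk_minimum \<xi> v" using assms extremal_imp_minimum by auto
  then have eq: "hk_energy u \<xi> = hk_energy v \<xi>"
    using adm by (force simp: hk_minimum_def)
  let ?w = "\<lambda>y. u y + (1/2) * (v y - u y)"
  have "?w \<in> admissible \<xi>" by (intro segment_admissible adm) auto
  then have "hk_energy u \<xi> \<le> hk_energy ?w \<xi>" using min by (simp add: hk_minimum_def)
  moreover have "hk_energy ?w \<xi> \<le> (1 - 1/2) * hk_energy u \<xi> + (1/2) * hk_energy v \<xi>"
    by (intro hk_energy_segment adm) auto
  ultimately show ?thesis
    using eq by (intro hk_energy_segment(2)[OF adm, of "1/2"]) auto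
qed

end

theorem corollary1p7:
  fixes \<xi> :: "real ^ 'n \<Rightarrow> complex ^ 'n ^ 'n"
  assumes "higgs_tensor \<xi>"
    and "semidefinite_field (\<lambda>y. map_matrix Re (\<xi> y))"
    and "semidefinite_field (\<lambda>y. map_matrix Im (\<xi> y))"
  shows "(\<forall>u. hk_extremal \<xi> u \<longrightarrow> hk_minimum \<xi> u) \<and>
         (\<forall>u v. hk_extremal \<xi> u \<longrightarrow> hk_extremal \<xi> v \<longrightarrow> (\<exists>c. \<forall>y. v y = u y + c))"
  using extremal_imp_minimum[OF assms] extremal_unique[OF assms] by blast

end
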